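(* Let $\mathbf{k}$ be a field, let $m>1$ be an integer, and let $I_m\subseteq\mathbf{k}[x_{11},x_{12},\dots,x_{m1},x_{m2}]$ be the ideal given by $$I_m=\langle x_{11}^3x_{12},\dots,x_{m1}^3x_{m2},\ x_{11}^2x_{21}x_{22},\ \dots,\ x_{(m-1)1}^2x_{m1}x_{m2},\ x_{m1}^2x_{11}x_{12}\rangle,$$ i.e. generated by $x_{i1}^3x_{i2}$ for $1\le i\le m$, by $x_{i1}^2x_{(i+1)1}x_{(i+1)2}$ for $1\le i\le m-1$, and by $x_{m1}^2x_{11}x_{12}$. The Betti numbers of $I_m$ are given by $$\beta_0(I_m)=2m,\qquad \beta_i(I_m)=2K^m_{m-3,i-1}+K^m_{m-2,i}\quad (i\ge1),$$ where the numbers $K^m_{a,b}$ are given by the recurrence relation $$K^m_{a,b}=K^m_{a-2,b-1}+K^m_{a-1,b}$$ with base cases $$K^m_{a,0}=m+a,\qquad K^m_{0,i}=\binom{m}{i+1},\qquad K^m_{1,i}=\binom{m}{i}+\binom{m}{i+1}.$$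
   Context: $\beta_i(I)$ is the $i$-th total Betti number of the ideal $I$ as a module over the polynomial ring (so $\beta_0(I)$ is the number of minimal generators).
   Formalization: The base case K_{a,0}=m+a is read only for a≥0; for a=-1 (needed only when m=2) the value forced by the recurrence, K_{-1,b}=binom(m,b+1), is used, since m+a at a=-1 contradicts the recurrence and would give β_1(I_2)=3 instead of 5. *)

theory Defs
  imports
    Complex_Main
    "HOL-Library.Poly_Mapping"
    "HOL-Algebra.Ideal"
    "Jordan_Normal_Form.Matrix"
begin

section \<open>Polynomial rings\<close>

text \<open>
  Monomials are exponent vectors of type \<open>'v \<Rightarrow>\<^sub>0 nat\<close>, and polynomials are finitely supported
  coefficient functions on monomials. The ring \<open>k[V]\<close> consists of those polynomials that only
  involve variables from the set \<open>V\<close>.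
\<close>

type_synonym ('v, 'k) mpoly = "('v \<Rightarrow>\<^sub>0 nat) \<Rightarrow>\<^sub>0 'k"

definition polys :: "'v set \<Rightarrow> ('v, 'k::field) mpoly set" where
  "polys V = {p. \<forall>t \<in> Poly_Mapping.keys p. Poly_Mapping.keys t \<subseteq> V}"

definition poly_ring :: "'v set \<Rightarrow> ('v, 'k::field) mpoly ring" where
  "poly_ring V = \<lparr>carrier = polys V, monoid.mult = (*), one = 1, zero = 0, add = (+)\<rparr>"

definition Var :: "'v \<Rightarrow> ('v, 'k::field) mpoly" where
  "Var v = Poly_Mapping.single (Poly_Mapping.single v 1) 1"

definition mon_deg :: "('v \<Rightarrow>\<^sub>0 nat) \<Rightarrow> nat" where
  "mon_deg t = (\<Sum>v \<in> Poly_Mapping.keys t. Poly_Mapping.lookup t v)"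

text \<open>The zero polynomial is homogeneous of every degree; it is the only homogeneous polynomial
  of negative degree.\<close>

definition homogeneous_of_deg :: "int \<Rightarrow> ('v, 'k::field) mpoly \<Rightarrow> bool" where
  "homogeneous_of_deg e p \<longleftrightarrow> (\<forall>t \<in> Poly_Mapping.keys p. int (mon_deg t) = e)"

lemma polys_0 [simp]: "0 \<in> polys V"
  by (simp add: polys_def)

lemma polys_1 [simp]: "1 \<in> polys V"
  by (simp add: polys_def)

lemma polys_add: "p \<in> polys V \<Longrightarrow> q \<in> polys V \<Longrightarrow> p + q \<in> polys V"
  using Poly_Mapping.keys_add[of p q] by (auto simp: polys_def)

lemma polys_uminus: "p \<in> polys V \<Longrightarrow> - p \<in> polys V"
  by (simp add: polys_def)

lemma polys_mult:
  assumes "p \<in> polys V" "q \<in> polys V"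
  shows "p * q \<in> polys V"
  unfolding polys_def
proof (intro CollectI ballI)
  fix t assume "t \<in> Poly_Mapping.keys (p * q)"
  then obtain a b where "t = a + b" "a \<in> Poly_Mapping.keys p" "b \<in> Poly_Mapping.keys q"
    using Poly_Mapping.keys_mult[of p q] by blast
  then show "Poly_Mapping.keys t \<subseteq> V"
    using assms Poly_Mapping.keys_add[of a b] by (fastforce simp: polys_def)
qed

lemma Var_in_polys: "v \<in> V \<Longrightarrow> Var v \<in> polys V"
  by (simp add: polys_def Var_def)

lemma poly_ring_simps [simp]:
  "carrier (poly_ring V) = polys V"
  "x \<otimes>\<^bsub>poly_ring V\<^esub> y = x * y"
  "x \<oplus>\<^bsub>poly_ring V\<^esub> y = x + y"
  "\<one>\<^bsub>poly_ring V\<^esub> = 1"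
  "\<zero>\<^bsub>poly_ring V\<^esub> = 0"
  by (simp_all add: poly_ring_def)

lemma cring_poly_ring: "cring (poly_ring V :: ('v, 'k::field) mpoly ring)"
proof (rule cringI)
  let ?R = "poly_ring V :: ('v, 'k) mpoly ring"
  show "abelian_group ?R"
  proof (rule abelian_groupI)
    fix x :: "('v, 'k) mpoly" assume "x \<in> carrier ?R"
    then show "\<exists>y\<in>carrier ?R. y \<oplus>\<^bsub>?R\<^esub> x = \<zero>\<^bsub>?R\<^esub>"
      by (intro bexI[of _ "- x"]) (simp_all add: polys_uminus)
  qed (simp_all add: polys_add ac_simps)
  show "comm_monoid ?R"
    by (rule comm_monoidI) (simp_all add: polys_mult ac_simps)
qed (simp add: algebra_simps)

section \<open>Minimal graded free resolutions and Betti numbers\<close>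

text \<open>The free module \<open>k[V]\<^sup>n\<close>, as column vectors.\<close>

definition free_mod :: "'v set \<Rightarrow> nat \<Rightarrow> ('v, 'k::field) mpoly vec set" where
  "free_mod V n = {x \<in> carrier_vec n. \<forall>j<n. x $ j \<in> polys V}"

text \<open>
  A minimal graded free resolution
  \<open>\<dots> \<longrightarrow> F 2 \<longrightarrow> F 1 \<longrightarrow> F 0 \<longrightarrow> I \<longrightarrow> 0\<close> over \<open>S = k[V]\<close>, where \<open>F i\<close> is the direct sum of the
  modules \<open>S(- d i j)\<close> for \<open>j < b i\<close>. The matrix \<open>D 0\<close> is the row describing the augmentation
  \<open>F 0 \<longrightarrow> I\<close>, and \<open>D (i + 1)\<close> describes the differential \<open>F (i + 1) \<longrightarrow> F i\<close>. Homogeneity of the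
  entries says that these maps preserve degrees. Minimality says that the image of
  \<open>F (i + 1)\<close> lies in \<open>\<mm> F i\<close> for the ideal \<open>\<mm>\<close> generated by the variables, i.e. that no entry of
  \<open>D (i + 1)\<close> has a constant term. The sequence of ranks \<open>b\<close> is not required to be eventually
  zero.
\<close>

definition minimal_graded_free_resolution ::
  "'v set \<Rightarrow> ('v, 'k::field) mpoly set \<Rightarrow> (nat \<Rightarrow> nat) \<Rightarrow> (nat \<Rightarrow> nat \<Rightarrow> int)
    \<Rightarrow> (nat \<Rightarrow> ('v, 'k) mpoly mat) \<Rightarrow> bool" where
  "minimal_graded_free_resolution V I b d D \<longleftrightarrow>
    D 0 \<in> carrier_mat 1 (b 0) \<and>
    (\<forall>i. D (Suc i) \<in> carrier_mat (b i) (b (Suc i))) \<and>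
    (\<forall>i. elements_mat (D i) \<subseteq> polys V) \<and>
    (\<forall>c < b 0. homogeneous_of_deg (d 0 c) (D 0 $$ (0, c))) \<and>
    (\<forall>i. \<forall>r < b i. \<forall>c < b (Suc i).
      homogeneous_of_deg (d (Suc i) c - d i r) (D (Suc i) $$ (r, c))) \<and>
    (\<lambda>x. (D 0 *\<^sub>v x) $ 0) ` free_mod V (b 0) = I \<and>
    (\<forall>i. (\<lambda>x. D (Suc i) *\<^sub>v x) ` free_mod V (b (Suc i))
      = {x \<in> free_mod V (b i). D i *\<^sub>v x = 0\<^sub>v (dim_row (D i))}) \<and>
    (\<forall>i. \<forall>r < b i. \<forall>c < b (Suc i). Poly_Mapping.lookup (D (Suc i) $$ (r, c)) 0 = 0)"

text \<open>The \<open>i\<close>-th total Betti number of a homogeneous ideal \<open>I\<close> of \<open>k[V]\<close>, for finite \<open>V\<close>.\<close>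

definition betti :: "'v set \<Rightarrow> ('v, 'k::field) mpoly set \<Rightarrow> nat \<Rightarrow> nat" where
  "betti V I i = (THE n. \<exists>b d D. minimal_graded_free_resolution V I b d D \<and> b i = n)"

section \<open>The ideals\<close>

definition I_vars :: "nat \<Rightarrow> (nat \<times> nat) set" where
  "I_vars m = {1..m} \<times> {1, 2}"

definition I_gens :: "nat \<Rightarrow> (nat \<times> nat, 'k::field) mpoly set" where
  "I_gens m =
    (\<lambda>i. Var (i, 1) ^ 3 * Var (i, 2)) ` {1..m} \<union>
    (\<lambda>i. Var (i, 1) ^ 2 * Var (i + 1, 1) * Var (i + 1, 2)) ` {1..m - 1} \<union>
    {Var (m, 1) ^ 2 * Var (1, 1) * Var (1, 2)}"

definition I_ideal :: "nat \<Rightarrow> (nat \<times> nat, 'k::field) mpoly set" where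
  "I_ideal m = Idl\<^bsub>poly_ring (I_vars m)\<^esub> (I_gens m)"

section \<open>The numbers K\<close>

text \<open>
  The formula for the Betti numbers uses \<open>a = -1\<close> when \<open>m = 2\<close>. The base cases are read as
  statements about \<open>a \<ge> 0\<close>, and the values at \<open>a = -1\<close> are those forced by the recurrence at
  \<open>a = 1\<close>; see \<open>K_unique\<close>. (Reading \<open>K m a 0 = m + a\<close> at \<open>a = -1\<close> would contradict the
  recurrence at \<open>a = b = 1\<close>.) The values for \<open>a < -1\<close> are irrelevant.
\<close>

fun K_nat :: "nat \<Rightarrow> nat \<Rightarrow> nat \<Rightarrow> nat" where
  "K_nat m 0 b = m choose (b + 1)"
| "K_nat m (Suc 0) b = (m choose b) + (m choose (b + 1))"
| "K_nat m (Suc (Suc a)) 0 = m + Suc (Suc a)"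
| "K_nat m (Suc (Suc a)) (Suc b) = K_nat m a b + K_nat m (Suc a) (Suc b)"

definition K :: "nat \<Rightarrow> int \<Rightarrow> nat \<Rightarrow> nat" where
  "K m a b = (if a \<ge> 0 then K_nat m (nat a) b else if a = -1 then m choose (b + 1) else 0)"

lemma K_base:
  "a \<ge> 0 \<Longrightarrow> int (K m a 0) = int m + a"
  "K m 0 i = m choose (i + 1)"
  "K m 1 i = (m choose i) + (m choose (i + 1))"
proof -
  have "K_nat m n 0 = m + n" for n
    by (cases "(m, n, 0 :: nat)" rule: K_nat.cases) auto
  then show "a \<ge> 0 \<Longrightarrow> int (K m a 0) = int m + a"
    by (simp add: K_def)
qed (simp_all add: K_def)

lemma K_rec:
  assumes "a \<ge> 1" "b \<ge> 1"
  shows "K m a b = K m (a - 2) (b - 1) + K m (a - 1) b"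
proof (cases "a = 1")
  case True
  then show ?thesis using assms by (simp add: K_def)
next
  case False
  define n where "n = nat (a - 2)"
  have n: "a = int n + 2" using False assms(1) by (simp add: n_def)
  obtain c where c: "b = Suc c" using assms(2) by (cases b) auto
  have "nat a = Suc (Suc n)" "nat (a - 1) = Suc n" "nat (a - 2) = n"
    using n by auto
  then show ?thesis using n c by (simp add: K_def)
qed

lemma K_unique:
  fixes L :: "int \<Rightarrow> nat \<Rightarrow> nat"
  assumes base: "\<And>a. a \<ge> 0 \<Longrightarrow> int (L a 0) = int m + a"
      "\<And>i. L 0 i = m choose (i + 1)"
      "\<And>i. L 1 i = (m choose i) + (m choose (i + 1))"
    and rec: "\<And>a b. a \<ge> 1 \<Longrightarrow> b \<ge> 1 \<Longrightarrow> L a b = L (a - 2) (b - 1) + L (a - 1) b"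
    and "a \<ge> -1"
  shows "L a b = K m a b"
proof (cases "a = -1")
  case True
  have "L 1 (Suc b) = L (-1) b + L 0 (Suc b)"
    using rec[of 1 "Suc b"] by simp
  then show ?thesis using True base by (simp add: K_def)
next
  case False
  have "L (int n) b = K_nat m n b" for n
  proof (induction n arbitrary: b rule: induct_nat_012)
    case (ge2 n)
    show ?case
    proof (cases b)
      case 0
      then show ?thesis using base(1)[of "int (Suc (Suc n))"] by simp
    next
      case (Suc c)
      have "L (int (Suc (Suc n))) (Suc c) = L (int n) c + L (int (Suc n)) (Suc c)"
        using rec[of "int (Suc (Suc n))" "Suc c"] by (simp add: algebra_simps)
      then show ?thesis using ge2 Suc by simp
    qed
  qed (simp_all add: base)
  from this[of "nat a"] show ?thesis using False assms(5) by (simp add: K_def)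
qed

end

theory Submission
  imports Defs "Jordan_Normal_Form.Determinant" "HOL-Library.Product_Lexorder"
begin

text \<open>
  Write \<open>a\<^sub>i = x\<^sub>i\<^sub>1\<^sup>3 x\<^sub>i\<^sub>2\<close> and \<open>b\<^sub>i = x\<^sub>i\<^sub>1\<^sup>2 x\<^sub>j\<^sub>1 x\<^sub>j\<^sub>2\<close>, where \<open>j\<close> is the cyclic successor of \<open>i\<close>. Since \<open>b\<^sub>i\<close> strictly
  divides the least common multiple of \<open>a\<^sub>i\<close> and \<open>a\<^sub>j\<close>, these two should not span an edge. In fact
  the minimal resolution is simplicial: its faces are the sets \<open>A \<union> B\<close> with \<open>A\<close> an independent
  set of the cycle formed by the \<open>a\<^sub>i\<close> and \<open>B\<close> any set of \<open>b\<^sub>i\<close>. For a monomial \<open>t\<close> in the ideal,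
  the faces dividing \<open>t\<close> form a cone: its apex is any \<open>b\<^sub>i\<close> dividing \<open>t\<close>, and if there is none, then
  no two adjacent \<open>a\<^sub>i\<close> divide \<open>t\<close> and every \<open>a\<^sub>i\<close> dividing \<open>t\<close> is an apex. So \<open>\<beta>\<^sub>i\<close> is the number of
  such faces with \<open>i + 1\<close> elements. Replacing the cycle by a path on \<open>a\<close> vertices, the number of
  faces with \<open>b + 1\<close> elements satisfies the recurrence of \<open>K m a b\<close>; splitting the
  independent sets of the cycle according to whether they contain \<open>1\<close>, \<open>m\<close> or neither yields
  the formula.
\<close>

section \<open>Uniqueness of Betti numbers\<close>

lemma lookup_mult_zero:
  "Poly_Mapping.lookup (p * q) 0 = Poly_Mapping.lookup p 0 * Poly_Mapping.lookup q 0"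
  for p q :: "('v, 'k::field) mpoly"
proof -
  have add0: "(0 = a + b) = (b = 0 \<and> a = 0)" for a b :: "'v \<Rightarrow>\<^sub>0 nat"
    by (auto simp: poly_mapping_eq_iff lookup_add fun_eq_iff)
  have *: "(\<Sum>q'. Poly_Mapping.lookup q q' when 0 = l + q')
      = (Poly_Mapping.lookup q 0 when l = 0)" for l :: "'v \<Rightarrow>\<^sub>0 nat"
    by (subst add0) (cases "l = 0", simp_all)
  show ?thesis
    unfolding lookup_mult * by (simp add: mult_when)
qed

text \<open>Reduction modulo the variables therefore commutes with matrix products, which moves rank
  questions from \<open>k[V]\<close> to the field.\<close>

lemma semiring_hom_constant_term:
  "semiring_hom (\<lambda>p :: ('v, 'k::field) mpoly. Poly_Mapping.lookup p 0)"
  by unfold_locales (simp_all add: lookup_add lookup_mult_zero)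

lemma polys_minus: "p \<in> polys V \<Longrightarrow> q \<in> polys V \<Longrightarrow> p - q \<in> polys V"
  using polys_add[OF _ polys_uminus] by fastforce

lemma polys_sum: "(\<And>i. i \<in> A \<Longrightarrow> f i \<in> polys V) \<Longrightarrow> sum f A \<in> polys V"
  by (induction A rule: infinite_finite_induct) (simp_all add: polys_add)

definition pmat :: "'v set \<Rightarrow> nat \<Rightarrow> nat \<Rightarrow> ('v, 'k::field) mpoly mat set" where
  "pmat V p q = {M \<in> carrier_mat p q. \<forall>i<p. \<forall>j<q. M $$ (i, j) \<in> polys V}"

lemma pmat_carrier: "M \<in> pmat V p q \<Longrightarrow> M \<in> carrier_mat p q"
  by (simp add: pmat_def)

lemma pmat_mult: "A \<in> pmat V p q \<Longrightarrow> B \<in> pmat V q r \<Longrightarrow> A * B \<in> pmat V p r"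
  by (auto simp: pmat_def scalar_prod_def intro!: polys_sum polys_mult)

lemma pmat_minus: "A \<in> pmat V p q \<Longrightarrow> B \<in> pmat V p q \<Longrightarrow> A - B \<in> pmat V p q"
  by (auto simp: pmat_def intro!: polys_minus)

lemma pmat_one: "1\<^sub>m n \<in> pmat V n n"
  by (auto simp: pmat_def)

lemma col_pmat: "A \<in> pmat V p q \<Longrightarrow> j < q \<Longrightarrow> col A j \<in> free_mod V p"
  by (auto simp: pmat_def free_mod_def)

lemma pmat_mult_free_mod: "A \<in> pmat V p q \<Longrightarrow> x \<in> free_mod V q \<Longrightarrow> A *\<^sub>v x \<in> free_mod V p"
  by (auto simp: pmat_def free_mod_def scalar_prod_def intro!: polys_sum polys_mult)

lemma unit_vec_free_mod: "unit_vec n j \<in> free_mod V n"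
  by (auto simp: free_mod_def unit_vec_def)

lemma mult_mat_unit_vec:
  fixes A :: "'a::comm_semiring_1 mat"
  assumes "A \<in> carrier_mat p q" "j < q"
  shows "A *\<^sub>v unit_vec q j = col A j"
  using assms by (intro eq_vecI) (auto simp: scalar_prod_right_unit)

text \<open>Free modules are projective: a preimage is chosen for each column of \<open>M\<close>,
  and these preimages become the columns of \<open>X\<close>.\<close>

lemma pmat_factorization:
  assumes N: "N \<in> pmat V p r" and M: "M \<in> carrier_mat p q"
    and im: "\<And>j. j < q \<Longrightarrow> col M j \<in> (\<lambda>x. N *\<^sub>v x) ` free_mod V r"
  shows "\<exists>X \<in> pmat V r q. N * X = M"
proof -
  have "\<forall>j. \<exists>x. j < q \<longrightarrow> x \<in> free_mod V r \<and> col M j = N *\<^sub>v x"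
    using im by blast
  then obtain x where x: "\<And>j. j < q \<Longrightarrow> x j \<in> free_mod V r"
      "\<And>j. j < q \<Longrightarrow> col M j = N *\<^sub>v x j"
    by metis
  define X where "X = mat_of_cols r (map x [0..<q])"
  have colX: "col X j = x j" if "j < q" for j
    using x(1)[OF that] that by (simp add: X_def free_mod_def)
  have X: "X \<in> carrier_mat r q"
    by (simp add: X_def mat_of_cols_carrier(1)[of r "map x [0..<q]", simplified])
  have "X $$ (i, j) = x j $ i" if "i < r" "j < q" for i j
    using that by (simp add: X_def mat_of_cols_def)
  then have "X \<in> pmat V r q"
    using X x(1) by (auto simp: pmat_def free_mod_def)
  moreover have "N * X = M"
  proof (rule eq_matI)
    fix i j assume "i < dim_row M" "j < dim_col M"
    then have ij: "i < p" "j < q" using M by auto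
    have "(N * X) $$ (i, j) = (N *\<^sub>v col X j) $ i"
      using N X ij by (auto simp: pmat_def)
    also have "\<dots> = M $$ (i, j)"
      using ij M by (simp add: colX flip: x(2))
    finally show "(N * X) $$ (i, j) = M $$ (i, j)" .
  qed (use N X M in \<open>auto simp: pmat_def\<close>)
  ultimately show ?thesis by blast
qed

lemma inverse_mats_eq_size:
  fixes A :: "'k::field mat"
  assumes A: "A \<in> carrier_mat p q" and B: "B \<in> carrier_mat q p" and AB: "A * B = 1\<^sub>m p"
  shows "p \<le> q"
proof (rule ccontr)
  assume "\<not> p \<le> q"
  then have q: "q < p" by simp
  \<comment> \<open>Padding \<open>A\<close> and \<open>B\<close> with zeros to square matrices makes the last row of \<open>B\<close> vanish.\<close>
  define A' where "A' = mat p p (\<lambda>(i, j). if j < q then A $$ (i, j) else 0)"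
  define B' where "B' = mat p p (\<lambda>(i, j). if i < q then B $$ (i, j) else 0)"
  have A'B': "A' \<in> carrier_mat p p" "B' \<in> carrier_mat p p"
    by (simp_all add: A'_def B'_def)
  have "A' * B' = A * B"
  proof (rule eq_matI)
    fix i j assume "i < dim_row (A * B)" "j < dim_col (A * B)"
    then have ij: "i < p" "j < p" using A B by auto
    have "(A' * B') $$ (i, j) = (\<Sum>k<p. if k < q then A $$ (i, k) * B $$ (k, j) else 0)"
      using ij by (auto simp: A'_def B'_def scalar_prod_def atLeast0LessThan intro!: sum.cong)
    also have "\<dots> = (\<Sum>k<q. A $$ (i, k) * B $$ (k, j))"
      using q by (intro sum.mono_neutral_cong_right) auto
    also have "\<dots> = (A * B) $$ (i, j)"
      using A B ij by (auto simp: scalar_prod_def atLeast0LessThan)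
    finally show "(A' * B') $$ (i, j) = (A * B) $$ (i, j)" .
  qed (use A B in \<open>auto simp: A'_def B'_def\<close>)
  \<comment> \<open>For square matrices over a field a one-sided inverse is two-sided. Row
    \<open>q\<close> of \<open>B'\<close> is zero, so this is absurd at position
    \<open>(q, q)\<close>.\<close>
  then have "B' * A' = 1\<^sub>m p"
    using mat_mult_left_right_inverse[OF A'B'] AB by simp
  then have "(B' * A') $$ (q, q) = 1" using q by simp
  moreover have "(B' * A') $$ (q, q) = 0"
    using q by (auto simp: A'_def B'_def scalar_prod_def intro!: sum.neutral)
  ultimately show False by simp
qed

section \<open>Minimal resolutions with their degrees forgotten, and lifting along them\<close>

locale min_res =
  fixes V :: "'v set" and I :: "('v, 'k::field) mpoly set" and b :: "nat \<Rightarrow> nat"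
    and D :: "nat \<Rightarrow> ('v, 'k) mpoly mat"
  assumes D0: "D 0 \<in> pmat V 1 (b 0)" and DS: "\<And>i. D (Suc i) \<in> pmat V (b i) (b (Suc i))"
    and im0: "(\<lambda>x. (D 0 *\<^sub>v x) $ 0) ` free_mod V (b 0) = I"
    and exact: "\<And>i. (\<lambda>x. D (Suc i) *\<^sub>v x) ` free_mod V (b (Suc i))
      = {x \<in> free_mod V (b i). D i *\<^sub>v x = 0\<^sub>v (dim_row (D i))}"
    and minimal: "\<And>i r c. r < b i \<Longrightarrow> c < b (Suc i) \<Longrightarrow>
      Poly_Mapping.lookup (D (Suc i) $$ (r, c)) 0 = 0"
begin

text \<open>The rank of the target of \<open>D i\<close>. The value 1 at 0 stands for the ring as
  target of the augmentation, so that \<open>D 0\<close> and the differentials can be treated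
  alike.\<close>

definition rk :: "nat \<Rightarrow> nat" where
  "rk i = (case i of 0 \<Rightarrow> 1 | Suc j \<Rightarrow> b j)"

lemma D: "D i \<in> pmat V (rk i) (b i)"
  using D0 DS by (cases i) (simp_all add: rk_def)

lemma D_carrier: "D i \<in> carrier_mat (rk i) (b i)"
  using D by (rule pmat_carrier)

lemma rk_Suc [simp]: "rk (Suc i) = b i"
  by (simp add: rk_def)

lemma D_D: "D i * D (Suc i) = 0\<^sub>m (rk i) (b (Suc i))"
proof (rule eq_matI)
  fix r c assume "r < dim_row (0\<^sub>m (rk i) (b (Suc i)))" "c < dim_col (0\<^sub>m (rk i) (b (Suc i)))"
  then have rc: "r < rk i" "c < b (Suc i)" by auto
  have "D (Suc i) *\<^sub>v unit_vec (b (Suc i)) c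
      \<in> {x \<in> free_mod V (b i). D i *\<^sub>v x = 0\<^sub>v (dim_row (D i))}"
    unfolding exact[symmetric] using unit_vec_free_mod by blast
  then have "D i *\<^sub>v col (D (Suc i)) c = 0\<^sub>v (dim_row (D i))"
    using rc D_carrier[of "Suc i"] by (auto simp: mult_mat_unit_vec)
  then show "(D i * D (Suc i)) $$ (r, c) = 0\<^sub>m (rk i) (b (Suc i)) $$ (r, c)"
    using rc D_carrier[of i] D_carrier[of "Suc i"]
    by (metis carrier_matD index_mult_mat(1) index_mult_mat_vec index_zero_mat(1) index_zero_vec(1))
qed (use D_carrier[of i] D_carrier[of "Suc i"] in auto)

text \<open>Each column of \<open>M\<close> is a cycle, hence a boundary by exactness.\<close>

lemma lift:
  assumes M: "M \<in> pmat V (b i) q" and "D i * M = 0\<^sub>m (rk i) q"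
  shows "\<exists>X \<in> pmat V (b (Suc i)) q. D (Suc i) * X = M"
proof (rule pmat_factorization[OF DS pmat_carrier[OF M]])
  fix j assume j: "j < q"
  have "D i *\<^sub>v col M j = col (D i * M) j"
    using D_carrier[of i] pmat_carrier[OF M] j by simp
  then have "D i *\<^sub>v col M j = 0\<^sub>v (dim_row (D i))"
    using assms j D_carrier[of i] by simp
  then show "col M j \<in> (\<lambda>x. D (Suc i) *\<^sub>v x) ` free_mod V (b (Suc i))"
    unfolding exact using col_pmat[OF M j] by simp
qed

text \<open>Tensoring a map of free modules with the residue field \<open>k\<close>; minimality
  makes every \<open>D (Suc i)\<close> vanish under it.\<close>

definition const :: "('v, 'k) mpoly mat \<Rightarrow> 'k mat" where
  "const = map_mat (\<lambda>p. Poly_Mapping.lookup p 0)"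

lemma const_carrier: "M \<in> carrier_mat p q \<Longrightarrow> const M \<in> carrier_mat p q"
  by (simp add: const_def)

lemma const_mult:
  "A \<in> carrier_mat p q \<Longrightarrow> B \<in> carrier_mat q r \<Longrightarrow> const (A * B) = const A * const B"
  unfolding const_def by (rule semiring_hom.mat_hom_mult[OF semiring_hom_constant_term])

lemma const_D: "const (D (Suc i)) = 0\<^sub>m (b i) (b (Suc i))"
  using D_carrier[of "Suc i"] by (intro eq_matI) (auto simp: const_def minimal)

lemma const_homotopy:
  assumes C: "C \<in> carrier_mat (b i) (b i)" and "const (C - 1\<^sub>m (b i)) = 0\<^sub>m (b i) (b i)"
  shows "const C = 1\<^sub>m (b i)"
proof (rule eq_matI)
  fix r c assume "r < dim_row (1\<^sub>m (b i) :: 'k mat)" "c < dim_col (1\<^sub>m (b i) :: 'k mat)"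
  then have rc: "r < b i" "c < b i" by auto
  have "const (C - 1\<^sub>m (b i)) $$ (r, c) = 0"
    using assms rc by simp
  then show "const C $$ (r, c) = 1\<^sub>m (b i) $$ (r, c)"
    using rc C by (auto simp: const_def lookup_minus lookup_one split: if_splits)
qed (use C in \<open>auto simp: const_def\<close>)

text \<open>A lift \<open>C\<close> of the identity of \<open>I\<close> is homotopic to the identity; the homotopy is built one
  matrix \<open>h\<close> at a time, and the second conjunct is what allows the next one to be found.\<close>

lemma identity_lift_const:
  assumes C: "\<And>i. C i \<in> pmat V (b i) (b i)"
    and C0: "D 0 * C 0 = D 0" and CS: "\<And>i. D (Suc i) * C (Suc i) = C i * D (Suc i)"
  shows "const (C i) = 1\<^sub>m (b i) \<and>
    (\<exists>h \<in> pmat V (b (Suc i)) (b i). (C i - 1\<^sub>m (b i) - D (Suc i) * h) * D (Suc i)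
      = 0\<^sub>m (b i) (b (Suc i)))"
proof -
  \<comment> \<open>One step with a previous homotopy \<open>g\<close>: by \<open>z\<close> the
    columns of \<open>C i - 1 - g * D i\<close> are cycles, and lifting them through
    \<open>D (Suc i)\<close> gives the next homotopy \<open>h\<close>.\<close>
  have step: "const (C i) = 1\<^sub>m (b i) \<and>
      (\<exists>h \<in> pmat V (b (Suc i)) (b i). (C i - 1\<^sub>m (b i) - D (Suc i) * h) * D (Suc i)
        = 0\<^sub>m (b i) (b (Suc i)))"
    if g: "g \<in> pmat V (b i) (rk i)" and z: "D i * (C i - 1\<^sub>m (b i) - g * D i) = 0\<^sub>m (rk i) (b i)"
      and cg: "const (g * D i) = 0\<^sub>m (b i) (b i)"
    for g i
  proof -
    have gD: "g * D i \<in> pmat V (b i) (b i)"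
      using g D by (rule pmat_mult)
    have M: "C i - 1\<^sub>m (b i) - g * D i \<in> pmat V (b i) (b i)"
      by (intro pmat_minus C pmat_one gD)
    from lift[OF M z] obtain h where h: "h \<in> pmat V (b (Suc i)) (b i)"
      and Dh: "D (Suc i) * h = C i - 1\<^sub>m (b i) - g * D i" by blast
    note car = pmat_carrier[OF g] pmat_carrier[OF h] pmat_carrier[OF C[of i]]
      D_carrier[of i] pmat_carrier[OF DS[of i]] pmat_carrier[OF gD]
    \<comment> \<open>Both summands have zero constant part: the first has a differential as a
      factor, the second by \<open>cg\<close>.\<close>
    have "C i - 1\<^sub>m (b i) = D (Suc i) * h + g * D i"
      unfolding Dh using car by (intro eq_matI) auto
    then have "const (C i - 1\<^sub>m (b i)) = const (D (Suc i) * h) + const (g * D i)"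
      using car by (intro eq_matI) (auto simp: const_def lookup_add)
    also have "\<dots> = 0\<^sub>m (b i) (b i)"
      using car const_D[of i] const_carrier[OF car(2)]
      by (simp add: const_mult[OF car(5) car(2)] cg)
    finally have "const (C i) = 1\<^sub>m (b i)"
      by (rule const_homotopy[OF car(3)])
    moreover have "(C i - 1\<^sub>m (b i) - D (Suc i) * h) * D (Suc i) = 0\<^sub>m (b i) (b (Suc i))"
    proof -
      have "C i - 1\<^sub>m (b i) - D (Suc i) * h = g * D i"
        unfolding Dh using car by (intro eq_matI) auto
      then have "(C i - 1\<^sub>m (b i) - D (Suc i) * h) * D (Suc i) = g * (D i * D (Suc i))"
        using car by (simp add: assoc_mult_mat[OF car(1) car(4) car(5)])
      then show ?thesis using car by (simp add: D_D)
    qed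
    ultimately show ?thesis using h by blast
  qed
  show ?thesis
  proof (induction i)
    case 0
    \<comment> \<open>The homotopy below degree 0 is zero. Minimality does not restrict the constant
      terms of \<open>D 0\<close>, so \<open>cg\<close> comes from \<open>g = 0\<close>.\<close>
    have "D 0 * (C 0 - 1\<^sub>m (b 0) - 0\<^sub>m (b 0) 1 * D 0) = D 0 * (C 0 - 1\<^sub>m (b 0))"
      using pmat_carrier[OF C[of 0]] pmat_carrier[OF D0]
      by (intro arg_cong[where f = "(*) (D 0)"] eq_matI) auto
    also have "\<dots> = 0\<^sub>m 1 (b 0)"
      using pmat_carrier[OF C[of 0]] pmat_carrier[OF D0]
      by (simp add: mult_minus_distrib_mat[of _ 1 "b 0" _ "b 0"] C0 minus_r_inv_mat)
    finally have "D 0 * (C 0 - 1\<^sub>m (b 0) - 0\<^sub>m (b 0) 1 * D 0) = 0\<^sub>m 1 (b 0)" .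
    then show ?case
      using pmat_carrier[OF D0]
      by (intro step[of "0\<^sub>m (b 0) 1"])
        (auto simp: rk_def pmat_def const_def intro!: eq_matI)
  next
    case (Suc i)
    then obtain h where h: "h \<in> pmat V (b (Suc i)) (b i)"
      and hz: "(C i - 1\<^sub>m (b i) - D (Suc i) * h) * D (Suc i) = 0\<^sub>m (b i) (b (Suc i))" by blast
    note car = pmat_carrier[OF h] pmat_carrier[OF C[of i]] pmat_carrier[OF C[of "Suc i"]]
      pmat_carrier[OF DS[of i]]
    have ci: "D (Suc i) * h \<in> carrier_mat (b i) (b i)" "h * D (Suc i) \<in> carrier_mat (b (Suc i)) (b (Suc i))"
      using car by auto
    \<comment> \<open>Since \<open>C\<close> is a chain map, the new condition \<open>z\<close> is
      the second conjunct of the induction hypothesis.\<close>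
    have "D (Suc i) * (C (Suc i) - 1\<^sub>m (b (Suc i)) - h * D (Suc i))
        = D (Suc i) * C (Suc i) - D (Suc i) - D (Suc i) * (h * D (Suc i))"
    proof -
      have "D (Suc i) * (C (Suc i) - 1\<^sub>m (b (Suc i)) - h * D (Suc i))
          = D (Suc i) * (C (Suc i) - 1\<^sub>m (b (Suc i))) - D (Suc i) * (h * D (Suc i))"
        by (rule mult_minus_distrib_mat[OF car(4) _ ci(2)]) (rule minus_carrier_mat, simp)
      also have "D (Suc i) * (C (Suc i) - 1\<^sub>m (b (Suc i))) = D (Suc i) * C (Suc i) - D (Suc i)"
        using mult_minus_distrib_mat[OF car(4,3) one_carrier_mat] car(4) by simp
      finally show ?thesis .
    qed
    also have "\<dots> = (C i - 1\<^sub>m (b i) - D (Suc i) * h) * D (Suc i)"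
    proof -
      have "(C i - 1\<^sub>m (b i) - D (Suc i) * h) * D (Suc i)
          = (C i - 1\<^sub>m (b i)) * D (Suc i) - D (Suc i) * h * D (Suc i)"
        by (rule minus_mult_distrib_mat[OF _ ci(1) car(4)]) (rule minus_carrier_mat, simp)
      also have "(C i - 1\<^sub>m (b i)) * D (Suc i) = D (Suc i) * C (Suc i) - D (Suc i)"
        using minus_mult_distrib_mat[OF car(2) one_carrier_mat car(4)] car(4) by (simp add: CS)
      also have "D (Suc i) * h * D (Suc i) = D (Suc i) * (h * D (Suc i))"
        by (rule assoc_mult_mat[OF car(4) car(1) car(4)])
      finally show ?thesis by (rule sym)
    qed
    also note hz
    finally show ?case
      using h car const_D[of i] const_carrier[OF car(1)]
      by (intro step[of h]) (simp_all add: const_mult[OF car(1) car(4)])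
  qed
qed

end

text \<open>The comparison theorem: the identity of \<open>I\<close> lifts to a chain map, built one
  matrix at a time from freeness of the source and exactness of the target.\<close>

lemma min_res_comparison:
  fixes V :: "'v set" and I :: "('v, 'k::field) mpoly set"
  assumes "min_res V I b D" "min_res V I b' D'"
  shows "\<exists>A. (\<forall>i. A i \<in> pmat V (b' i) (b i)) \<and> D' 0 * A 0 = D 0 \<and>
    (\<forall>i. D' (Suc i) * A (Suc i) = A i * D (Suc i))"
proof -
  interpret R: min_res V I b D by fact
  interpret R': min_res V I b' D' by fact
  \<comment> \<open>The second conjunct says that \<open>A * D (Suc i)\<close> maps into the kernel
    of \<open>D' i\<close>; this invariant lets \<open>lift\<close> find the next matrix.\<close>
  let ?P = "\<lambda>i A. A \<in> pmat V (b' i) (b i) \<and> D' i * A * D (Suc i) = 0\<^sub>m (R'.rk i) (b (Suc i)) \<and>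
    (i = 0 \<longrightarrow> D' 0 * A = D 0)"
  have "\<exists>A. \<forall>i. ?P i (A i) \<and> D' (Suc i) * A (Suc i) = A i * D (Suc i)"
  proof (rule dependent_nat_choice)
    \<comment> \<open>Both augmentations have image \<open>I\<close>, so each entry of the row
      \<open>D 0\<close> is a value of \<open>D' 0\<close>.\<close>
    have "\<exists>X \<in> pmat V (b' 0) (b 0). D' 0 * X = D 0"
    proof (rule pmat_factorization[OF R'.D0 pmat_carrier[OF R.D0]])
      fix j assume j: "j < b 0"
      have "(D 0 *\<^sub>v unit_vec (b 0) j) $ 0 \<in> (\<lambda>x. (D' 0 *\<^sub>v x) $ 0) ` free_mod V (b' 0)"
        unfolding R'.im0 using R.im0 unit_vec_free_mod by blast
      then obtain x where x: "x \<in> free_mod V (b' 0)" "col (D 0) j $ 0 = (D' 0 *\<^sub>v x) $ 0"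
        using mult_mat_unit_vec[OF pmat_carrier[OF R.D0] j] by auto
      have "col (D 0) j = D' 0 *\<^sub>v x"
        using x(2) pmat_carrier[OF R.D0] pmat_carrier[OF R'.D0] by (intro eq_vecI) auto
      then show "col (D 0) j \<in> (\<lambda>x. D' 0 *\<^sub>v x) ` free_mod V (b' 0)"
        using x(1) by blast
    qed
    then show "\<exists>A. ?P 0 A"
      using R.D_D[of 0] by (auto simp: R.rk_def R'.rk_def)
  next
    fix A i assume A: "?P i A"
    then have A': "A \<in> pmat V (b' i) (b i)" by simp
    have "D' i * (A * D (Suc i)) = 0\<^sub>m (R'.rk i) (b (Suc i))"
      using A assoc_mult_mat[OF R'.D_carrier pmat_carrier[OF A'] pmat_carrier[OF R.DS]] by simp
    from R'.lift[OF pmat_mult[OF A' R.DS] this]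
    obtain X where X: "X \<in> pmat V (b' (Suc i)) (b (Suc i))" "D' (Suc i) * X = A * D (Suc i)"
      by blast
    have "A * D (Suc i) * D (Suc (Suc i)) = A * (D (Suc i) * D (Suc (Suc i)))"
      using assoc_mult_mat[OF pmat_carrier[OF A'] pmat_carrier[OF R.DS] pmat_carrier[OF R.DS]] .
    also have "\<dots> = 0\<^sub>m (b' i) (b (Suc (Suc i)))"
      using pmat_carrier[OF A'] R.D_D[of "Suc i"] by simp
    finally show "\<exists>B. ?P (Suc i) B \<and> D' (Suc i) * B = A * D (Suc i)"
      using X by (intro exI[of _ X]) simp
  qed
  then show ?thesis by blast
qed

text \<open>Composing the comparison maps in both directions gives a lift of the identity, whose
  constant part is the identity matrix. So the identity of size \<open>b i\<close> factors over the
  field through size \<open>b' i\<close>.\<close>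

lemma min_res_rank_le:
  fixes V :: "'v set" and I :: "('v, 'k::field) mpoly set"
  assumes res: "min_res V I b D" "min_res V I b' D'"
  shows "b i \<le> b' i"
proof -
  interpret R: min_res V I b D by fact
  interpret R': min_res V I b' D' by fact
  obtain A where A: "\<And>i. A i \<in> pmat V (b' i) (b i)" "D' 0 * A 0 = D 0"
      "\<And>i. D' (Suc i) * A (Suc i) = A i * D (Suc i)"
    using min_res_comparison[OF res] by blast
  obtain B where B: "\<And>i. B i \<in> pmat V (b i) (b' i)" "D 0 * B 0 = D' 0"
      "\<And>i. D (Suc i) * B (Suc i) = B i * D' (Suc i)"
    using min_res_comparison[OF res(2,1)] by blast
  note car = pmat_carrier[OF A(1)] pmat_carrier[OF B(1)] pmat_carrier[OF R.D0]
    pmat_carrier[OF R.DS] pmat_carrier[OF R'.DS]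
  have "R.const (B i * A i) = 1\<^sub>m (b i)"
  proof (rule R.identity_lift_const[of "\<lambda>i. B i * A i", THEN conjunct1])
    show "B i * A i \<in> pmat V (b i) (b i)" for i
      using B(1) A(1) by (rule pmat_mult)
    show "D 0 * (B 0 * A 0) = D 0"
      by (simp add: A(2) B(2) flip: assoc_mult_mat[OF car(3,2,1)])
    show "D (Suc i) * (B (Suc i) * A (Suc i)) = B i * A i * D (Suc i)" for i
    proof -
      have "D (Suc i) * (B (Suc i) * A (Suc i)) = B i * D' (Suc i) * A (Suc i)"
        by (simp add: B(3) flip: assoc_mult_mat[OF car(4,2,1)])
      also have "\<dots> = B i * (A i * D (Suc i))"
        by (simp add: A(3) assoc_mult_mat[OF car(2,5,1)])
      also have "\<dots> = B i * A i * D (Suc i)"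
        by (simp add: assoc_mult_mat[OF car(2,1,4)])
      finally show ?thesis .
    qed
  qed
  then have "R.const (B i) * R.const (A i) = 1\<^sub>m (b i)"
    by (simp add: R.const_mult[OF car(2,1)])
  then show ?thesis
    by (rule inverse_mats_eq_size[OF R.const_carrier[OF car(2)] R.const_carrier[OF car(1)]])
qed

lemma min_res_if_minimal_graded_free_resolution:
  assumes "minimal_graded_free_resolution V I b d D"
  shows "min_res V I b D"
proof -
  have el: "M \<in> pmat V p q" if "M \<in> carrier_mat p q" "elements_mat M \<subseteq> polys V"
    for M :: "('a, 'b) mpoly mat" and p q
    using that by (auto simp: pmat_def)
  show ?thesis
    using assms unfolding minimal_graded_free_resolution_def
    by (intro min_res.intro) (auto intro!: el)
qed

text \<open>The rank inequality in both directions makes the description in \<open>betti\<close>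
  unique, so exhibiting one resolution suffices.\<close>

lemma betti_eq:
  assumes "minimal_graded_free_resolution V I b d D"
  shows "betti V I i = b i"
  unfolding betti_def
proof (rule the_equality)
  show "\<exists>b' d D. minimal_graded_free_resolution V I b' d D \<and> b' i = b i"
    using assms by blast
next
  fix n assume "\<exists>b d D. minimal_graded_free_resolution V I b d D \<and> b i = n"
  then obtain b' d' D' where b': "minimal_graded_free_resolution V I b' d' D'" "b' i = n"
    by blast
  then show "n = b i"
    using min_res_rank_le assms min_res_if_minimal_graded_free_resolution
    by (metis le_antisym)
qed

section \<open>Simplicial resolutions of monomial ideals\<close>

definition mdvd :: "('v \<Rightarrow>\<^sub>0 nat) \<Rightarrow> ('v \<Rightarrow>\<^sub>0 nat) \<Rightarrow> bool" where
  "mdvd s t \<longleftrightarrow> (\<forall>x. Poly_Mapping.lookup s x \<le> Poly_Mapping.lookup t x)"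

lemma mdvd_refl [simp]: "mdvd s s"
  by (simp add: mdvd_def)

lemma mdvd_trans: "mdvd s t \<Longrightarrow> mdvd t u \<Longrightarrow> mdvd s u"
  by (meson mdvd_def order_trans)

lemma mdvd_add [simp]: "mdvd s (t + s)"
  by (simp add: mdvd_def lookup_add)

lemma diff_add_mdvd: "mdvd s t \<Longrightarrow> t - s + s = t"
  by (rule poly_mapping_eqI) (simp add: mdvd_def lookup_add lookup_minus)

lemma keys_mdvd: "mdvd s t \<Longrightarrow> Poly_Mapping.keys s \<subseteq> Poly_Mapping.keys t"
  by (auto simp: mdvd_def in_keys_iff) (metis not_gr_zero leD)

lemma keys_diff_subset: "Poly_Mapping.keys (s - t) \<subseteq> Poly_Mapping.keys s"
  for s t :: "'v \<Rightarrow>\<^sub>0 nat"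
  by (auto simp: in_keys_iff lookup_minus)

lemma lookup_single_mult:
  fixes p :: "('v, 'k::field) mpoly"
  shows "Poly_Mapping.lookup (Poly_Mapping.single u a * p) s
    = (if mdvd u s then a * Poly_Mapping.lookup p (s - u) else 0)"
proof -
  have *: "(\<Sum>q. Poly_Mapping.lookup p q when s = u + q)
      = (if mdvd u s then Poly_Mapping.lookup p (s - u) else 0)"
  proof (cases "mdvd u s")
    case True
    then have "(s = u + q) = (q = s - u)" for q
      using diff_add_mdvd[OF True] by (auto simp: add.commute)
    then show ?thesis using True by simp
  next
    case False
    then have "s \<noteq> u + q" for q
      using mdvd_add[of u q] by (metis add.commute)
    then show ?thesis using False by simp
  qed
  have "Poly_Mapping.lookup (Poly_Mapping.single u a * p) s
      = (\<Sum>l. (a * (\<Sum>q. Poly_Mapping.lookup p q when s = u + q)) when l = u)"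
    unfolding lookup_mult lookup_single
    by (intro Sum_any.cong) (auto simp: when_def)
  then show ?thesis by (simp add: *)
qed

lemma mon_deg_superset:
  "finite A \<Longrightarrow> Poly_Mapping.keys t \<subseteq> A \<Longrightarrow> mon_deg t = (\<Sum>v\<in>A. Poly_Mapping.lookup t v)"
  unfolding mon_deg_def by (intro sum.mono_neutral_left) (auto simp: in_keys_iff)

lemma mon_deg_add: "mon_deg (s + t) = mon_deg s + mon_deg t"
  using keys_add[of s t]
  by (simp add: mon_deg_superset[of "Poly_Mapping.keys s \<union> Poly_Mapping.keys t"]
      lookup_add sum.distrib)

text \<open>The image consists of the linear combinations of the entries. They form an ideal, which
  contains the entries as images of unit vectors; conversely each combination lies in the generated
  ideal, by induction on the summands.\<close>

lemma row_image_eq_Idl: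
  fixes M :: "('v, 'k::field) mpoly mat"
  assumes M: "M \<in> pmat V 1 n"
  shows "(\<lambda>x. (M *\<^sub>v x) $ 0) ` free_mod V n = Idl\<^bsub>poly_ring V\<^esub> ((\<lambda>j. M $$ (0, j)) ` {..<n})"
    (is "?J = Idl\<^bsub>?R\<^esub> ?G")
proof (rule antisym)
  interpret R: cring ?R by (rule cring_poly_ring)
  have M': "M \<in> carrier_mat 1 n" using M by (rule pmat_carrier)
  have G: "?G \<subseteq> carrier ?R"
    using M by (auto simp: pmat_def)
  have apply_sum: "(M *\<^sub>v x) $ 0 = (\<Sum>j<n. M $$ (0, j) * x $ j)" if "x \<in> free_mod V n" for x
    using that M' by (auto simp: free_mod_def scalar_prod_def atLeast0LessThan)
  have G_J: "?G \<subseteq> ?J"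
  proof
    fix g assume "g \<in> ?G"
    then obtain j where "j < n" "g = M $$ (0, j)" by auto
    then have "g = (M *\<^sub>v unit_vec n j) $ 0"
      using M' by (simp add: mult_mat_unit_vec[OF M'] col_def del: index_mult_mat_vec)
    then show "g \<in> ?J" using unit_vec_free_mod by blast
  qed
  have sub: "?J \<subseteq> carrier ?R"
    using M by (auto simp: apply_sum pmat_def free_mod_def intro!: polys_sum polys_mult)
  have "ideal ?J ?R"
  proof (rule idealI)
    show "ring ?R" by (rule R.ring_axioms)
    have closed: "r * a \<in> ?J" if a: "a \<in> ?J" and r: "r \<in> polys V" for a r
    proof -
      obtain x where x: "a = (M *\<^sub>v x) $ 0" "x \<in> free_mod V n" using a by (rule imageE)
      have rx: "r \<cdot>\<^sub>v x \<in> free_mod V n"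
        using x(2) r by (auto simp: free_mod_def intro!: polys_mult)
      have "r * a = (M *\<^sub>v (r \<cdot>\<^sub>v x)) $ 0"
        unfolding x(1) apply_sum[OF x(2)] apply_sum[OF rx] sum_distrib_left
        using x(2) by (intro sum.cong) (auto simp: free_mod_def mult.left_commute)
      then show ?thesis using rx by blast
    qed
    have add: "a + a' \<in> ?J" if a: "a \<in> ?J" "a' \<in> ?J" for a a'
    proof -
      obtain x where x: "a = (M *\<^sub>v x) $ 0" "x \<in> free_mod V n" using a(1) by (rule imageE)
      obtain x' where x': "a' = (M *\<^sub>v x') $ 0" "x' \<in> free_mod V n" using a(2) by (rule imageE)
      have xx: "x + x' \<in> free_mod V n"
        using x(2) x'(2) by (auto simp: free_mod_def intro!: polys_add)
      have "a + a' = (M *\<^sub>v (x + x')) $ 0"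
        unfolding x(1) x'(1) apply_sum[OF x(2)] apply_sum[OF x'(2)] apply_sum[OF xx]
          sum.distrib[symmetric]
        using x(2) x'(2) by (intro sum.cong) (auto simp: free_mod_def distrib_left)
      then show ?thesis using xx by blast
    qed
    show "r \<otimes>\<^bsub>?R\<^esub> a \<in> ?J" "a \<otimes>\<^bsub>?R\<^esub> r \<in> ?J" if "a \<in> ?J" "r \<in> carrier ?R" for a r
      using closed[of a r] that by (simp_all add: mult.commute)
    show "subgroup ?J (add_monoid ?R)"
    proof (rule R.add.subgroupI)
      show "?J \<noteq> {}" by (auto simp: free_mod_def intro!: exI[of _ "0\<^sub>v n"])
      show "a \<oplus>\<^bsub>?R\<^esub> a' \<in> ?J" if "a \<in> ?J" "a' \<in> ?J" for a a'
        using add that by simp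
      show "\<ominus>\<^bsub>?R\<^esub> a \<in> ?J" if "a \<in> ?J" for a
      proof -
        have a: "a \<in> polys V" using that sub by auto
        have "\<ominus>\<^bsub>?R\<^esub> a = - a"
          by (rule R.minus_equality) (use a in \<open>simp_all add: polys_uminus\<close>)
        moreover have "- 1 * a \<in> ?J"
          by (rule closed[OF that]) (simp add: polys_uminus)
        ultimately show ?thesis by simp
      qed
    qed (rule sub)
  qed
  then show "Idl\<^bsub>?R\<^esub> ?G \<subseteq> ?J"
    using G_J by (rule R.genideal_minimal)
  interpret Id: ideal "Idl\<^bsub>?R\<^esub> ?G" ?R
    by (rule R.genideal_ideal[OF G])
  show "?J \<subseteq> Idl\<^bsub>?R\<^esub> ?G"
  proof
    fix a assume "a \<in> ?J"
    then obtain x where x: "x \<in> free_mod V n" "a = (\<Sum>j<n. M $$ (0, j) * x $ j)"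
      using apply_sum by auto
    have "(\<Sum>j\<in>A. M $$ (0, j) * x $ j) \<in> Idl\<^bsub>?R\<^esub> ?G" if "A \<subseteq> {..<n}" for A
      using finite_subset[OF that finite_lessThan] that
    proof (induction A rule: finite_induct)
      case empty
      then show ?case using Id.zero_closed by simp
    next
      case (insert j A)
      then have "M $$ (0, j) \<otimes>\<^bsub>?R\<^esub> x $ j \<in> Idl\<^bsub>?R\<^esub> ?G"
        using x by (intro Id.I_r_closed subsetD[OF R.genideal_self[OF G]])
          (auto simp: free_mod_def)
      then show ?case using insert Id.a_closed by fastforce
    qed
    then show "a \<in> Idl\<^bsub>?R\<^esub> ?G" using x by simp
  qed
qed

section \<open>Simplicial chains: boundary and cone\<close>

definition incidence_sign :: "'a::linorder \<Rightarrow> 'a set \<Rightarrow> 'k::comm_ring_1" where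
  "incidence_sign v \<tau> = (- 1) ^ card {u \<in> \<tau>. u < v}"

lemma incidence_sign_square [simp]: "incidence_sign v \<tau> * incidence_sign v \<tau> = 1"
  by (simp add: incidence_sign_def flip: power_mult_distrib)

lemma incidence_sign_insert:
  assumes "finite \<tau>" "v \<notin> \<tau>"
  shows "incidence_sign u (insert v \<tau>)
    = (if v < u then - incidence_sign u \<tau> else incidence_sign u \<tau> :: 'k::comm_ring_1)"
proof -
  have "{w \<in> insert v \<tau>. w < u} = (if v < u then insert v {w \<in> \<tau>. w < u} else {w \<in> \<tau>. w < u})"
    by auto
  then show ?thesis using assms by (simp add: incidence_sign_def)
qed

text \<open>Of two distinct vertices exactly one lies below the other, and only the sign of the
  upper one changes when the other is inserted.\<close>

lemma incidence_sign_swap: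
  assumes "finite \<tau>" "u \<noteq> v" "u \<notin> \<tau>" "v \<notin> \<tau>"
  shows "incidence_sign v \<tau> * incidence_sign u (insert v \<tau>)
    = - (incidence_sign u \<tau> * incidence_sign v (insert u \<tau>) :: 'k::comm_ring_1)"
  using assms by (auto simp: incidence_sign_insert algebra_simps)

text \<open>The simplicial boundary on coefficient functions: \<open>c\<close> stands for a chain
  with coefficient \<open>c \<sigma>\<close> at \<sigma>, and the coefficient of its boundary at
  \<tau> collects the sets with one more vertex.\<close>

definition bd :: "'a::linorder set \<Rightarrow> ('a set \<Rightarrow> 'k::comm_ring_1) \<Rightarrow> 'a set \<Rightarrow> 'k" where
  "bd W c \<tau> = (\<Sum>v\<in>W - \<tau>. incidence_sign v \<tau> * c (insert v \<tau>))"

text \<open>Two vertices are added to \<tau> in two orders, with opposite signs.\<close>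

lemma bd_bd:
  assumes W: "finite W" and \<tau>: "finite \<tau>"
  shows "bd W (bd W c) \<tau> = 0"
proof -
  define f where "f v u = incidence_sign v \<tau> * (incidence_sign u (insert v \<tau>) * c (insert u (insert v \<tau>)))"
    for v u
  define P where "P = (W - \<tau>) \<times> (W - \<tau>)"
  have "bd W (bd W c) \<tau> = (\<Sum>v\<in>W - \<tau>. \<Sum>u\<in>W - insert v \<tau>. f v u)"
    by (simp add: bd_def sum_distrib_left f_def)
  also have "\<dots> = (\<Sum>(v, u)\<in>(SIGMA v:W - \<tau>. W - insert v \<tau>). f v u)"
    using W by (intro sum.Sigma) auto
  also have "(SIGMA v:W - \<tau>. W - insert v \<tau>) = {(v, u) \<in> P. v < u} \<union> {(v, u) \<in> P. u < v}"
    by (auto simp: P_def)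
  also have "(\<Sum>(v, u)\<in>\<dots>. f v u) = (\<Sum>(v, u)\<in>{(v, u) \<in> P. v < u}. f v u) + (\<Sum>(v, u)\<in>{(v, u) \<in> P. u < v}. f v u)"
    using W by (intro sum.union_disjoint) (auto simp: P_def intro: finite_subset[of _ "W \<times> W"])
  also have "(\<Sum>(v, u)\<in>{(v, u) \<in> P. u < v}. f v u) = (\<Sum>(v, u)\<in>{(v, u) \<in> P. v < u}. f u v)"
    by (rule sum.reindex_bij_witness[of _ prod.swap prod.swap]) (auto simp: P_def)
  also have "\<dots> = (\<Sum>(v, u)\<in>{(v, u) \<in> P. v < u}. - f v u)"
  proof (intro sum.cong refl, clarify)
    fix v u assume "(v, u) \<in> P" "v < u"
    then have "f u v = incidence_sign u \<tau> * incidence_sign v (insert u \<tau>) * c (insert v (insert u \<tau>))"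
      by (simp add: f_def mult.assoc)
    also have "\<dots> = - (incidence_sign v \<tau> * incidence_sign u (insert v \<tau>)) * c (insert u (insert v \<tau>))"
      using \<tau> \<open>(v, u) \<in> P\<close> \<open>v < u\<close>
      by (subst incidence_sign_swap) (auto simp: P_def insert_commute)
    finally show "f u v = - f v u" by (simp add: f_def mult.assoc)
  qed
  finally show ?thesis
    by (simp add: sum_negf case_prod_unfold)
qed

text \<open>Coning with \<open>w\<close> is a contracting homotopy: the boundary of the cone over
  \<open>c\<close> is \<open>c\<close> minus the cone over the boundary of \<open>c\<close>, and the
  latter vanishes for a cycle.\<close>

lemma bd_cone:
  fixes c :: "'a::linorder set \<Rightarrow> 'k::comm_ring_1"
  assumes W: "finite W" "w \<in> W" and supp: "\<And>\<tau>. \<not> \<tau> \<subseteq> W \<Longrightarrow> c \<tau> = 0" and cycle: "bd W c = (\<lambda>_. 0)"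
  shows "bd W (\<lambda>\<rho>. if w \<in> \<rho> then incidence_sign w (\<rho> - {w}) * c (\<rho> - {w}) else 0) = c"
proof -
  define e where "e = (\<lambda>\<rho>. if w \<in> \<rho> then incidence_sign w (\<rho> - {w}) * c (\<rho> - {w}) else 0)"
  have "bd W e \<tau> = c \<tau>" for \<tau>
  proof (cases "\<tau> \<subseteq> W")
    case False
    then obtain x where x: "x \<in> \<tau>" "x \<notin> W" by blast
    have "e (insert v \<tau>) = 0" for v
    proof -
      have "x \<noteq> w" using x(2) W(2) by metis
      then have "\<not> insert v \<tau> - {w} \<subseteq> W" using x by blast
      then have "c (insert v \<tau> - {w}) = 0" by (rule supp)
      then show ?thesis by (simp only: mult_zero_right if_cancel e_def)
    qed
    then have "bd W e \<tau> = 0"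
      unfolding bd_def by (simp only: mult_zero_right sum.neutral_const)
    also have "\<dots> = c \<tau>" by (rule supp[OF False, symmetric])
    finally show ?thesis .
  next
    case True
    then have \<tau>: "finite \<tau>" using W finite_subset by blast
    show ?thesis
    proof (cases "w \<in> \<tau>")
      case False
      \<comment> \<open>Only \<open>v = w\<close> yields a set that contains
        \<open>w\<close>.\<close>
      have "bd W e \<tau> = (\<Sum>v\<in>{w}. incidence_sign v \<tau> * e (insert v \<tau>))"
        unfolding bd_def using False W by (intro sum.mono_neutral_right) (auto simp: e_def)
      also have "\<dots> = c \<tau>"
        using False by (simp add: e_def flip: mult.assoc)
      finally show ?thesis .
    next
      case wt: True
      define \<tau>' where "\<tau>' = \<tau> - {w}"
      have \<tau>': "\<tau> = insert w \<tau>'" "w \<notin> \<tau>'" "finite \<tau>'"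
        using wt \<tau> by (auto simp: \<tau>'_def)
      have WW: "W - \<tau>' = insert w (W - \<tau>)" using W \<tau>' by auto
      \<comment> \<open>The cycle condition at \<open>\<tau>'\<close> expresses the sum over the
        vertices outside \<tau> by \<open>c \<tau>\<close>.\<close>
      have "0 = bd W c \<tau>'" by (simp add: cycle)
      also have "\<dots> = incidence_sign w \<tau>' * c \<tau> + (\<Sum>v\<in>W - \<tau>. incidence_sign v \<tau>' * c (insert v \<tau>'))"
        unfolding bd_def WW using W wt \<tau>' by (subst sum.insert) auto
      finally have cyc: "(\<Sum>v\<in>W - \<tau>. incidence_sign v \<tau>' * c (insert v \<tau>')) = - (incidence_sign w \<tau>' * c \<tau>)"
        unfolding eq_neg_iff_add_eq_0 by (subst add.commute) (rule sym)
      have "bd W e \<tau> = (\<Sum>v\<in>W - \<tau>. - incidence_sign w \<tau>' * (incidence_sign v \<tau>' * c (insert v \<tau>')))"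
        unfolding bd_def
      proof (intro sum.cong refl)
        fix v assume v: "v \<in> W - \<tau>"
        then have vw: "v \<noteq> w" "v \<notin> \<tau>'" using wt \<tau>' by auto
        have "insert v \<tau> - {w} = insert v \<tau>'" using vw \<tau>' by auto
        then have "incidence_sign v \<tau> * e (insert v \<tau>)
            = incidence_sign v (insert w \<tau>') * incidence_sign w (insert v \<tau>') * c (insert v \<tau>')"
          using wt \<tau>'(1) by (simp add: e_def mult.assoc)
        also have "incidence_sign v (insert w \<tau>') * incidence_sign w (insert v \<tau>')
            = - (incidence_sign w \<tau>' * incidence_sign v \<tau>' :: 'k)"
          using vw \<tau>' by (auto simp: incidence_sign_insert algebra_simps)
        finally show "incidence_sign v \<tau> * e (insert v \<tau>)
            = - incidence_sign w \<tau>' * (incidence_sign v \<tau>' * c (insert v \<tau>'))"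
          by (simp add: mult.assoc)
      qed
      also have "\<dots> = c \<tau>"
        unfolding sum_distrib_left[symmetric] cyc by (simp flip: mult.assoc)
      finally show ?thesis .
    qed
  qed
  then show ?thesis unfolding e_def by (rule ext)
qed

text \<open>The inserted 0 gives the empty set the label 1 (exponent 0) and \<open>Max\<close> a
  non-empty argument. Infinite sets get the same label as a default.\<close>

lift_definition mlcm :: "('a \<Rightarrow> 'v \<Rightarrow>\<^sub>0 nat) \<Rightarrow> 'a set \<Rightarrow> 'v \<Rightarrow>\<^sub>0 nat" is
  "\<lambda>l S x. if finite S then Max (insert 0 ((\<lambda>v. l v x) ` S)) else 0"
proof -
  fix l :: "'a \<Rightarrow> 'v \<Rightarrow> nat" and S :: "'a set"
  assume fin: "\<And>v. finite {x. l v x \<noteq> 0}"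
  show "finite {x. (if finite S then Max (insert 0 ((\<lambda>v. l v x) ` S)) else 0) \<noteq> 0}"
  proof (cases "finite S")
    case True
    have "x \<in> (\<Union>v\<in>S. {x. l v x \<noteq> 0})" if "Max (insert 0 ((\<lambda>v. l v x) ` S)) \<noteq> 0" for x
    proof -
      have "Max (insert 0 ((\<lambda>v. l v x) ` S)) \<in> insert 0 ((\<lambda>v. l v x) ` S)"
        using True by (intro Max_in) auto
      then show ?thesis using that by auto
    qed
    then have "{x. (if finite S then Max (insert 0 ((\<lambda>v. l v x) ` S)) else 0) \<noteq> 0}
        \<subseteq> (\<Union>v\<in>S. {x. l v x \<noteq> 0})"
      by (intro subsetI) (metis (mono_tags, lifting) True mem_Collect_eq)
    moreover have "finite (\<Union>v\<in>S. {x. l v x \<noteq> 0})"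
      using True fin by (rule finite_UN_I)
    ultimately show ?thesis by (rule finite_subset)
  qed simp
qed

lemma mlcm_mdvd_iff: "finite S \<Longrightarrow> mdvd (mlcm l S) t \<longleftrightarrow> (\<forall>v\<in>S. mdvd (l v) t)"
  unfolding mdvd_def by (simp add: mlcm.rep_eq) blast

lemma mlcm_empty [simp]: "mlcm l {} = 0"
  by (rule poly_mapping_eqI) (simp add: mlcm.rep_eq)

lemma mlcm_singleton [simp]: "mlcm l {v} = l v"
  by (rule poly_mapping_eqI) (simp add: mlcm.rep_eq)

lemma mdvd_mlcm: "finite S \<Longrightarrow> v \<in> S \<Longrightarrow> mdvd (l v) (mlcm l S)"
  using mlcm_mdvd_iff[of S l "mlcm l S"] by simp

lemma mlcm_mono: "finite T \<Longrightarrow> S \<subseteq> T \<Longrightarrow> mdvd (mlcm l S) (mlcm l T)"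
  using finite_subset[of S T] by (auto simp: mlcm_mdvd_iff mdvd_mlcm)

lemma keys_mlcm: "Poly_Mapping.keys (mlcm l S) \<subseteq> (\<Union>v\<in>S. Poly_Mapping.keys (l v))"
proof (cases "finite S")
  case True
  show ?thesis
  proof
    fix x assume "x \<in> Poly_Mapping.keys (mlcm l S)"
    then have "Max (insert 0 ((\<lambda>v. Poly_Mapping.lookup (l v) x) ` S)) \<noteq> 0"
      using True by (simp add: in_keys_iff mlcm.rep_eq)
    moreover have "Max (insert 0 ((\<lambda>v. Poly_Mapping.lookup (l v) x) ` S))
        \<in> insert 0 ((\<lambda>v. Poly_Mapping.lookup (l v) x) ` S)"
      using True by (intro Max_in) auto
    ultimately show "x \<in> (\<Union>v\<in>S. Poly_Mapping.keys (l v))"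
      by (auto simp: in_keys_iff)
  qed
next
  case False
  then show ?thesis by (auto simp: in_keys_iff mlcm.rep_eq)
qed

text \<open>If every nonempty subcomplex \<open>{\<sigma> \<in> \<Delta>. mlcm l \<sigma> | t}\<close> is a cone, the labelled complex supports
  a free resolution (a criterion of Bayer and Sturmfels); it is minimal if the labels of faces
  increase strictly.\<close>

locale labelled_complex =
  fixes W :: "'a::linorder set" and \<Delta> :: "'a set set" and l :: "'a \<Rightarrow> 'v \<Rightarrow>\<^sub>0 nat"
    and V :: "'v set"
  assumes finite_W: "finite W" and faces_W: "\<Delta> \<subseteq> Pow W"
    and empty_face: "{} \<in> \<Delta>" and face_subset: "\<And>\<sigma> \<tau>. \<sigma> \<in> \<Delta> \<Longrightarrow> \<tau> \<subseteq> \<sigma> \<Longrightarrow> \<tau> \<in> \<Delta>"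
    and keys_l: "\<And>v. v \<in> W \<Longrightarrow> Poly_Mapping.keys (l v) \<subseteq> V"
    and cone: "\<And>t v. {v} \<in> \<Delta> \<Longrightarrow> mdvd (l v) t \<Longrightarrow>
      \<exists>w\<in>W. mdvd (l w) t \<and> (\<forall>\<sigma>\<in>\<Delta>. mdvd (mlcm l \<sigma>) t \<longrightarrow> insert w \<sigma> \<in> \<Delta>)"
    and strict: "\<And>v \<tau>. v \<notin> \<tau> \<Longrightarrow> insert v \<tau> \<in> \<Delta> \<Longrightarrow> mlcm l (insert v \<tau>) \<noteq> mlcm l \<tau>"
begin

section \<open>Faces as bases of the free modules, and the differential\<close>

definition faces :: "nat \<Rightarrow> 'a set set" where
  "faces n = {\<sigma> \<in> \<Delta>. card \<sigma> = n}"

definition L :: "nat \<Rightarrow> 'a set list" where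
  "L n = (SOME xs. set xs = faces n \<and> distinct xs)"

lemma finite_\<Delta>: "finite \<Delta>"
  using finite_subset[OF faces_W] finite_W by simp

lemma set_L: "set (L n) = faces n" "distinct (L n)"
proof -
  have "\<exists>xs. set xs = faces n \<and> distinct xs"
    using finite_\<Delta> by (intro finite_distinct_list) (simp add: faces_def)
  then have "set (L n) = faces n \<and> distinct (L n)"
    unfolding L_def by (rule someI_ex)
  then show "set (L n) = faces n" "distinct (L n)" by auto
qed

lemma length_L: "length (L n) = card (faces n)"
  using distinct_card[OF set_L(2)] set_L(1) by metis

lemma L_nth: "j < length (L n) \<Longrightarrow> L n ! j \<in> faces n"
  using set_L(1) nth_mem by blast

lemma L_0: "L 0 = [{}]"
proof -
  have "faces 0 = {{}}"
    using faces_W empty_face finite_W by (auto simp: faces_def card_eq_0_iff dest: finite_subset)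
  then have "set (L 0) = {{}}" "length (L 0) = 1"
    by (simp_all add: set_L length_L)
  then show ?thesis by (cases "L 0") auto
qed

lemma finite_face: "\<sigma> \<in> \<Delta> \<Longrightarrow> finite \<sigma>"
  using faces_W finite_W finite_subset by blast

lemma insert_faces:
  assumes "v \<notin> \<tau>" "insert v \<tau> \<in> faces (Suc n)"
  shows "\<tau> \<in> faces n"
proof -
  have "insert v \<tau> \<in> \<Delta>" "card (insert v \<tau>) = Suc n" using assms by (auto simp: faces_def)
  moreover have "finite \<tau>" using finite_face[OF \<open>insert v \<tau> \<in> \<Delta>\<close>] by simp
  ultimately show ?thesis
    using assms(1) face_subset[of "insert v \<tau>" \<tau>] by (auto simp: faces_def)
qed

text \<open>At most one summand is non-zero, and its monomial is the quotient of the two labels. The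
  sum over vertices is the form that becomes \<open>bd\<close> once sums are exchanged.\<close>

definition entry :: "'a set \<Rightarrow> 'a set \<Rightarrow> ('v, 'k::field) mpoly" where
  "entry \<tau> \<sigma> = (\<Sum>v\<in>W - \<tau>. if insert v \<tau> = \<sigma>
    then Poly_Mapping.single (mlcm l \<sigma> - mlcm l \<tau>) (incidence_sign v \<tau>) else 0)"

text \<open>Indexed by the size of the target faces: \<open>diff 0\<close> is the augmentation, with
  the empty face as its only row.\<close>

definition diff :: "nat \<Rightarrow> ('v, 'k::field) mpoly mat" where
  "diff n = mat (length (L n)) (length (L (Suc n))) (\<lambda>(r, c). entry (L n ! r) (L (Suc n) ! c))"

lemma dim_diff [simp]: "dim_row (diff n) = length (L n)" "dim_col (diff n) = length (L (Suc n))"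
  by (simp_all add: diff_def)

lemma diff_index:
  "r < length (L n) \<Longrightarrow> c < length (L (Suc n)) \<Longrightarrow> diff n $$ (r, c) = entry (L n ! r) (L (Suc n) ! c)"
  by (simp add: diff_def)

lemma entry_insert:
  assumes "v \<in> W - \<tau>"
  shows "entry \<tau> (insert v \<tau>)
    = Poly_Mapping.single (mlcm l (insert v \<tau>) - mlcm l \<tau>) (incidence_sign v \<tau> :: 'k::field)"
proof -
  have "insert u \<tau> = insert v \<tau> \<longleftrightarrow> u = v" if "u \<in> W - \<tau>" for u
    using that assms by auto
  then have "entry \<tau> (insert v \<tau>) = (\<Sum>u\<in>W - \<tau>. if u = v
      then Poly_Mapping.single (mlcm l (insert v \<tau>) - mlcm l \<tau>) (incidence_sign v \<tau> :: 'k) else 0)"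
    unfolding entry_def by (intro sum.cong) auto
  then show ?thesis using assms finite_W by simp
qed

lemma entry_eq_0: "(\<And>v. v \<in> W - \<tau> \<Longrightarrow> \<sigma> \<noteq> insert v \<tau>) \<Longrightarrow> entry \<tau> \<sigma> = 0"
  unfolding entry_def by (intro sum.neutral) auto

lemma entry_cases:
  fixes \<tau> \<sigma> :: "'a set"
  obtains (zero) "entry \<tau> \<sigma> = (0 :: ('v, 'k::field) mpoly)"
  | (insert) v where "v \<in> W - \<tau>" "\<sigma> = insert v \<tau>"
      "entry \<tau> \<sigma> = (Poly_Mapping.single (mlcm l \<sigma> - mlcm l \<tau>) (incidence_sign v \<tau>)
        :: ('v, 'k) mpoly)"
  using entry_eq_0 entry_insert by metis

lemma keys_label: "\<sigma> \<in> \<Delta> \<Longrightarrow> Poly_Mapping.keys (mlcm l \<sigma>) \<subseteq> V"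
  using keys_mlcm[of l \<sigma>] keys_l faces_W by blast

lemma entry_polys:
  assumes "\<sigma> \<in> \<Delta>"
  shows "entry \<tau> \<sigma> \<in> (polys V :: ('v, 'k::field) mpoly set)"
proof (cases rule: entry_cases[where 'k = 'k, of \<tau> \<sigma>])
  case (insert v)
  have "Poly_Mapping.keys (mlcm l \<sigma> - mlcm l \<tau>) \<subseteq> V"
    using keys_diff_subset keys_label[OF assms] by (rule subset_trans)
  then show ?thesis by (simp add: insert(3) polys_def)
qed simp

lemma diff_pmat: "diff n \<in> pmat V (length (L n)) (length (L (Suc n)))"
  using L_nth entry_polys by (fastforce simp: diff_def pmat_def faces_def)

lemma diff_carrier_vec: "diff n *\<^sub>v x \<in> carrier_vec (length (L n))"
  by (rule carrier_vecI) (simp add: diff_def)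

text \<open>The component of \<open>x\<close> in multidegree \<open>t\<close>: the basis element belonging to a face \<open>\<sigma>\<close> has
  multidegree \<open>mlcm l \<sigma>\<close>.\<close>

definition coef :: "nat \<Rightarrow> ('v \<Rightarrow>\<^sub>0 nat) \<Rightarrow> ('v, 'k::field) mpoly vec \<Rightarrow> 'a set \<Rightarrow> 'k" where
  "coef n t x \<sigma> = (\<Sum>j<length (L n). if L n ! j = \<sigma> \<and> mdvd (mlcm l \<sigma>) t
    then Poly_Mapping.lookup (x $ j) (t - mlcm l \<sigma>) else 0)"

lemma coef_nth:
  assumes "j < length (L n)"
  shows "coef n t x (L n ! j) = (if mdvd (mlcm l (L n ! j)) t
    then Poly_Mapping.lookup (x $ j) (t - mlcm l (L n ! j)) else 0)"
proof -
  have "L n ! i = L n ! j \<longleftrightarrow> i = j" if "i < length (L n)" for i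
    using that assms set_L(2) by (simp add: nth_eq_iff_index_eq)
  then have "coef n t x (L n ! j) = (\<Sum>i<length (L n). if i = j then (if mdvd (mlcm l (L n ! j)) t
    then Poly_Mapping.lookup (x $ j) (t - mlcm l (L n ! j)) else 0) else 0)"
    unfolding coef_def by (intro sum.cong) auto
  then show ?thesis using assms by simp
qed

lemma coef_support: "coef n t x \<sigma> \<noteq> 0 \<Longrightarrow> \<sigma> \<in> faces n \<and> mdvd (mlcm l \<sigma>) t"
  using L_nth[of _ n] unfolding coef_def by (auto elim!: sum.not_neutral_contains_not_neutral split: if_splits)

lemma coef_notin_faces: "\<sigma> \<notin> faces n \<Longrightarrow> coef n t x \<sigma> = 0"
  using coef_support[of n t x \<sigma>] by metis

text \<open>The coefficient of \<open>x $ j\<close> at \<open>s\<close> is found in multidegree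
  \<open>s\<close> plus the label of the \<open>j\<close>-th face.\<close>

lemma coef_eqI:
  assumes "x \<in> carrier_vec (length (L n))" "y \<in> carrier_vec (length (L n))"
    and "\<And>t. coef n t x = coef n t y"
  shows "x = y"
proof (rule eq_vecI)
  fix j assume "j < dim_vec y"
  then have j: "j < length (L n)" using assms by simp
  show "x $ j = y $ j"
  proof (rule poly_mapping_eqI)
    fix s
    have "coef n (s + mlcm l (L n ! j)) x (L n ! j) = coef n (s + mlcm l (L n ! j)) y (L n ! j)"
      using assms(3) by simp
    then show "Poly_Mapping.lookup (x $ j) s = Poly_Mapping.lookup (y $ j) s"
      by (simp add: coef_nth[OF j])
  qed
qed (use assms in auto)

lemma coef_0 [simp]: "coef n t (0\<^sub>v (length (L n))) = (\<lambda>_. 0)"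
  unfolding coef_def by (rule ext, rule sum.neutral) simp

text \<open>In a fixed multidegree \<open>t\<close> the monomial factors of the entries only shift
  exponents, so the differential becomes the simplicial boundary on the faces whose labels divide
  \<open>t\<close>.\<close>

lemma coef_diff:
  assumes x: "x \<in> carrier_vec (length (L (Suc n)))"
  shows "coef n t (diff n *\<^sub>v x) = bd W (coef (Suc n) t x)"
proof
  fix \<tau>
  \<comment> \<open>If \<tau> is outside this subcomplex, so is every set with one more vertex, and
    both sides are 0.\<close>
  have vanish: "bd W (coef (Suc n) t x) \<tau> = 0" if "\<not> (\<tau> \<in> faces n \<and> mdvd (mlcm l \<tau>) t)"
  proof -
    have "coef (Suc n) t x (insert v \<tau>) = 0" if "v \<in> W - \<tau>" for v
    proof (rule ccontr)
      assume "coef (Suc n) t x (insert v \<tau>) \<noteq> 0"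
      from coef_support[OF this] have v: "insert v \<tau> \<in> faces (Suc n)" "mdvd (mlcm l (insert v \<tau>)) t"
        by auto
      then have "mdvd (mlcm l \<tau>) t"
        using mlcm_mono[of "insert v \<tau>" \<tau> l] finite_face[of "insert v \<tau>"]
          mdvd_trans[of "mlcm l \<tau>" "mlcm l (insert v \<tau>)" t] by (auto simp: faces_def)
      then show False
        using v insert_faces that \<open>\<not> (\<tau> \<in> faces n \<and> mdvd (mlcm l \<tau>) t)\<close> by blast
    qed
    then show ?thesis unfolding bd_def by simp
  qed
  show "coef n t (diff n *\<^sub>v x) \<tau> = bd W (coef (Suc n) t x) \<tau>"
  proof (cases "\<tau> \<in> faces n \<and> mdvd (mlcm l \<tau>) t")
    case False
    then show ?thesis using vanish coef_support by metis
  next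
    case True
    then obtain r where r: "r < length (L n)" "L n ! r = \<tau>"
      using set_L(1)[of n] by (metis in_set_conv_nth)
    \<comment> \<open>Dividing by the label of \<tau> and then by the quotient of the labels amounts
      to dividing by the larger label.\<close>
    have shift: "mdvd (mlcm l (insert v \<tau>) - mlcm l \<tau>) (t - mlcm l \<tau>) = mdvd (mlcm l (insert v \<tau>)) t"
      "t - mlcm l \<tau> - (mlcm l (insert v \<tau>) - mlcm l \<tau>) = t - mlcm l (insert v \<tau>)" for v
    proof -
      have "finite \<tau>" using True finite_face by (auto simp: faces_def)
      then have le: "mdvd (mlcm l \<tau>) (mlcm l (insert v \<tau>))"
        by (intro mlcm_mono) auto
      show "mdvd (mlcm l (insert v \<tau>) - mlcm l \<tau>) (t - mlcm l \<tau>) = mdvd (mlcm l (insert v \<tau>)) t"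
        using le True by (auto simp: mdvd_def lookup_minus le_diff_iff)
      show "t - mlcm l \<tau> - (mlcm l (insert v \<tau>) - mlcm l \<tau>) = t - mlcm l (insert v \<tau>)"
        using le by (intro poly_mapping_eqI) (simp add: mdvd_def lookup_minus)
    qed
    let ?m = "length (L (Suc n))"
    have "coef n t (diff n *\<^sub>v x) \<tau> = Poly_Mapping.lookup ((diff n *\<^sub>v x) $ r) (t - mlcm l \<tau>)"
      using True coef_nth[OF r(1), of t "diff n *\<^sub>v x"] unfolding r(2) by (simp only: if_True)
    also have "(diff n *\<^sub>v x) $ r = (\<Sum>j<?m. entry \<tau> (L (Suc n) ! j) * x $ j)"
      using r x by (simp add: diff_def scalar_prod_def atLeast0LessThan)
    also have "Poly_Mapping.lookup \<dots> (t - mlcm l \<tau>)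
        = (\<Sum>j<?m. \<Sum>v\<in>W - \<tau>. if insert v \<tau> = L (Suc n) ! j
            then (if mdvd (mlcm l (insert v \<tau>)) t then incidence_sign v \<tau>
              * Poly_Mapping.lookup (x $ j) (t - mlcm l (insert v \<tau>)) else 0) else 0)"
      unfolding entry_def sum_distrib_right lookup_sum
    proof (intro sum.cong refl)
      fix j v
      show "Poly_Mapping.lookup ((if insert v \<tau> = L (Suc n) ! j
            then Poly_Mapping.single (mlcm l (L (Suc n) ! j) - mlcm l \<tau>) (incidence_sign v \<tau>)
            else 0) * x $ j) (t - mlcm l \<tau>)
          = (if insert v \<tau> = L (Suc n) ! j
            then (if mdvd (mlcm l (insert v \<tau>)) t then incidence_sign v \<tau>
              * Poly_Mapping.lookup (x $ j) (t - mlcm l (insert v \<tau>)) else 0) else 0)"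
      proof (cases "insert v \<tau> = L (Suc n) ! j")
        case True
        then show ?thesis
          using shift[of v] by (simp add: lookup_single_mult)
      qed simp
    qed
    also have "\<dots> = bd W (coef (Suc n) t x) \<tau>"
      unfolding bd_def coef_def sum_distrib_left
      by (subst sum.swap) (intro sum.cong refl, auto)
    finally show ?thesis .
  qed
qed

text \<open>Components may be prescribed freely if their supports fit the faces and finitely many
  multidegrees occur; \<open>T\<close> guarantees entries of finite support with variables in
  \<open>V\<close>.\<close>

lemma coef_surj:
  fixes e :: "('v \<Rightarrow>\<^sub>0 nat) \<Rightarrow> 'a set \<Rightarrow> 'k::field"
  assumes supp: "\<And>t \<sigma>. e t \<sigma> \<noteq> 0 \<Longrightarrow> \<sigma> \<in> faces n \<and> mdvd (mlcm l \<sigma>) t"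
    and T: "finite T" "\<And>t. t \<in> T \<Longrightarrow> Poly_Mapping.keys t \<subseteq> V"
      "\<And>t \<sigma>. e t \<sigma> \<noteq> 0 \<Longrightarrow> t \<in> T"
  shows "\<exists>y \<in> free_mod V (length (L n)). \<forall>t. coef n t y = e t"
proof -
  define y where "y = vec (length (L n)) (\<lambda>j. Abs_poly_mapping (\<lambda>s. e (s + mlcm l (L n ! j)) (L n ! j)))"
  have lookup_y: "Poly_Mapping.lookup (y $ j) s = e (s + mlcm l (L n ! j)) (L n ! j)"
    if "j < length (L n)" for j s
  proof -
    have "{s. e (s + mlcm l (L n ! j)) (L n ! j) \<noteq> 0} \<subseteq> (\<lambda>s. s + mlcm l (L n ! j)) -` T"
      using T(3) by auto
    moreover have "finite ((\<lambda>s. s + mlcm l (L n ! j)) -` T)"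
      using T(1) by (rule finite_vimageI) (simp add: inj_def)
    ultimately have "finite {s. e (s + mlcm l (L n ! j)) (L n ! j) \<noteq> 0}"
      by (rule finite_subset)
    then show ?thesis using that by (simp add: y_def)
  qed
  have "y \<in> free_mod V (length (L n))"
  proof -
    have "Poly_Mapping.keys s \<subseteq> V" if "j < length (L n)" "s \<in> Poly_Mapping.keys (y $ j)" for j s
    proof -
      have "s + mlcm l (L n ! j) \<in> T"
        using that T(3)[of "s + mlcm l (L n ! j)" "L n ! j"] by (simp add: in_keys_iff lookup_y)
      then have "Poly_Mapping.keys (s + mlcm l (L n ! j)) \<subseteq> V" by (rule T(2))
      moreover have "mdvd s (s + mlcm l (L n ! j))"
        by (simp add: mdvd_def lookup_add)
      ultimately show ?thesis using keys_mdvd by blast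
    qed
    then show ?thesis by (auto simp: free_mod_def polys_def y_def)
  qed
  moreover have "coef n t y = e t" for t
  proof
    fix \<sigma>
    show "coef n t y \<sigma> = e t \<sigma>"
    proof (cases "\<sigma> \<in> faces n")
      case True
      then obtain j where j: "j < length (L n)" "L n ! j = \<sigma>"
        using set_L(1)[of n] by (metis in_set_conv_nth)
      show ?thesis
        using coef_nth[OF j(1), of t y] supp[of t \<sigma>] lookup_y[OF j(1)] j(2)
        by (auto simp: diff_add_mdvd)
    next
      case False
      then have "coef n t y \<sigma> = 0" "e t \<sigma> = 0" using coef_notin_faces supp by blast+
      then show ?thesis by simp
    qed
  qed
  ultimately show ?thesis by blast
qed

section \<open>Exactness, checked in each multidegree\<close>

lemma diff_diff:
  assumes "x \<in> carrier_vec (length (L (Suc (Suc n))))"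
  shows "diff n *\<^sub>v (diff (Suc n) *\<^sub>v x) = 0\<^sub>v (length (L n))"
proof (rule coef_eqI[where n = n])
  have D: "diff (Suc n) *\<^sub>v x \<in> carrier_vec (length (L (Suc n)))"
    by (rule diff_carrier_vec)
  show "coef n t (diff n *\<^sub>v (diff (Suc n) *\<^sub>v x)) = coef n t (0\<^sub>v (length (L n)))" for t
  proof
    fix \<tau>
    show "coef n t (diff n *\<^sub>v (diff (Suc n) *\<^sub>v x)) \<tau> = coef n t (0\<^sub>v (length (L n))) \<tau>"
    \<comment> \<open>\<open>bd_bd\<close> needs a finite \<tau>; sets that are not faces have
      coefficient 0 on both sides.\<close>
    proof (cases "\<tau> \<in> faces n")
      case True
      then have "finite \<tau>" using finite_face by (simp add: faces_def)
      then show ?thesis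
        by (simp only: coef_diff[OF D] coef_diff[OF assms] bd_bd[OF finite_W] coef_0)
    next
      case False
      then show ?thesis by (metis coef_notin_faces)
    qed
  qed
qed (simp_all only: diff_carrier_vec zero_carrier_vec)

text \<open>For the inclusion of the kernel, take the component of a cycle in multidegree
  \<open>t\<close>. If it is non-zero, the faces dividing \<open>t\<close> include a vertex and form
  a cone, so \<open>bd_cone\<close> yields a preimage; \<open>coef_surj\<close> assembles the
  preimages.\<close>

lemma exact:
  "(\<lambda>x. diff (Suc n) *\<^sub>v x) ` free_mod V (length (L (Suc (Suc n))))
    = {x \<in> free_mod V (length (L (Suc n))). diff n *\<^sub>v x = 0\<^sub>v (length (L n))}"
  (is "?im = ?ker")
proof (rule antisym)
  show "?im \<subseteq> ?ker"
    using diff_diff pmat_mult_free_mod[OF diff_pmat] by (auto simp: free_mod_def)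
  show "?ker \<subseteq> ?im"
  proof
    fix x assume "x \<in> ?ker"
    then have x: "x \<in> free_mod V (length (L (Suc n)))" "diff n *\<^sub>v x = 0\<^sub>v (length (L n))"
      by auto
    have x_car: "x \<in> carrier_vec (length (L (Suc n)))" using x by (simp add: free_mod_def)
    \<comment> \<open>By the last conjunct zero components get zero preimages, so that only
      multidegrees of \<open>x\<close> occur.\<close>
    have "\<exists>e. bd W e = coef (Suc n) t x
        \<and> (\<forall>\<rho>. e \<rho> \<noteq> 0 \<longrightarrow> \<rho> \<in> faces (Suc (Suc n)) \<and> mdvd (mlcm l \<rho>) t)
        \<and> (coef (Suc n) t x = (\<lambda>_. 0) \<longrightarrow> e = (\<lambda>_. 0))" for t
    proof (cases "coef (Suc n) t x = (\<lambda>_. 0)")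
      case True
      then show ?thesis by (intro exI[of _ "\<lambda>_. 0"]) (auto simp: bd_def)
    next
      case False
      then obtain \<sigma> where "coef (Suc n) t x \<sigma> \<noteq> 0" by auto
      then have \<sigma>: "\<sigma> \<in> faces (Suc n)" "mdvd (mlcm l \<sigma>) t" using coef_support by auto
      then obtain v where v: "v \<in> \<sigma>" "\<sigma> \<in> \<Delta>" by (fastforce simp: faces_def card_Suc_eq)
      have "{v} \<in> \<Delta>" using v face_subset by blast
      moreover have "mdvd (l v) t"
        using \<sigma> v mdvd_mlcm[of \<sigma> v] finite_face mdvd_trans by blast
      ultimately obtain w where w: "w \<in> W" "mdvd (l w) t"
          "\<And>\<sigma>. \<sigma> \<in> \<Delta> \<Longrightarrow> mdvd (mlcm l \<sigma>) t \<Longrightarrow> insert w \<sigma> \<in> \<Delta>"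
        using cone by blast
      let ?c = "coef (Suc n) t x"
      let ?e = "\<lambda>\<rho>. if w \<in> \<rho> then incidence_sign w (\<rho> - {w}) * ?c (\<rho> - {w}) else 0"
      have "bd W ?e = ?c"
      proof (rule bd_cone[OF finite_W w(1)])
        show "?c \<tau> = 0" if "\<not> \<tau> \<subseteq> W" for \<tau>
          using that coef_support[of "Suc n" t x \<tau>] faces_W by (auto simp: faces_def)
        show "bd W ?c = (\<lambda>_. 0)"
          by (simp add: x flip: coef_diff[OF x_car])
      qed
      moreover have "\<rho> \<in> faces (Suc (Suc n)) \<and> mdvd (mlcm l \<rho>) t" if "?e \<rho> \<noteq> 0" for \<rho>
      proof -
        from that have \<rho>: "w \<in> \<rho>" "?c (\<rho> - {w}) \<noteq> 0" by (auto split: if_splits)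
        from coef_support[OF \<rho>(2)] have f: "\<rho> - {w} \<in> \<Delta>" "card (\<rho> - {w}) = Suc n"
            "mdvd (mlcm l (\<rho> - {w})) t"
          by (auto simp: faces_def)
        have \<rho>_eq: "\<rho> = insert w (\<rho> - {w})" using \<rho> by auto
        then have "\<rho> \<in> \<Delta>" using w(3)[OF f(1,3)] by simp
        moreover have "card \<rho> = Suc (Suc n)"
          using finite_face[OF f(1)] f(2) \<rho>_eq by (metis card_insert_disjoint Diff_iff singletonI)
        moreover have "mdvd (mlcm l \<rho>) t"
          using f(3) w(2) finite_face[OF f(1)] finite_face[OF \<open>\<rho> \<in> \<Delta>\<close>]
          by (auto simp: mlcm_mdvd_iff)
        ultimately show ?thesis by (simp add: faces_def)
      qed
      ultimately show ?thesis using False by (intro exI[of _ ?e]) simp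
    qed
    then obtain e where e: "\<And>t. bd W (e t) = coef (Suc n) t x"
        "\<And>t \<rho>. e t \<rho> \<noteq> 0 \<Longrightarrow> \<rho> \<in> faces (Suc (Suc n)) \<and> mdvd (mlcm l \<rho>) t"
        "\<And>t. coef (Suc n) t x = (\<lambda>_. 0) \<Longrightarrow> e t = (\<lambda>_. 0)"
      by metis
    \<comment> \<open>The multidegrees occurring in \<open>x\<close>: exponents in its entries plus
      the labels of the basis elements.\<close>
    define T where "T = (\<Union>j<length (L (Suc n)).
      (\<lambda>s. s + mlcm l (L (Suc n) ! j)) ` Poly_Mapping.keys (x $ j))"
    have "\<exists>y \<in> free_mod V (length (L (Suc (Suc n)))). \<forall>t. coef (Suc (Suc n)) t y = e t"
    proof (rule coef_surj[OF e(2)])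
      show "finite T" by (simp add: T_def)
      show "Poly_Mapping.keys t \<subseteq> V" if t: "t \<in> T" for t
      proof -
        obtain j s where j: "j < length (L (Suc n))" "s \<in> Poly_Mapping.keys (x $ j)"
            "t = s + mlcm l (L (Suc n) ! j)"
          using t by (auto simp: T_def)
        have "Poly_Mapping.keys s \<subseteq> V" using x(1) j by (auto simp: free_mod_def polys_def)
        moreover have "Poly_Mapping.keys (mlcm l (L (Suc n) ! j)) \<subseteq> V"
          using L_nth[OF j(1)] keys_label by (auto simp: faces_def)
        ultimately show ?thesis
          using keys_add[of s "mlcm l (L (Suc n) ! j)"] j(3) by blast
      qed
      show "t \<in> T" if nz: "e t \<rho> \<noteq> 0" for t \<rho>
      proof -
        obtain \<sigma> where \<sigma>: "coef (Suc n) t x \<sigma> \<noteq> 0" using nz e(3)[of t] by fastforce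
        then have "\<sigma> \<in> faces (Suc n)" "mdvd (mlcm l \<sigma>) t" using coef_support by auto
        then obtain j where j: "j < length (L (Suc n))" "L (Suc n) ! j = \<sigma>"
          using set_L(1)[of "Suc n"] by (metis in_set_conv_nth)
        have "t - mlcm l \<sigma> \<in> Poly_Mapping.keys (x $ j)"
          using \<sigma> coef_nth[OF j(1), of t x] j(2) by (auto simp: in_keys_iff split: if_splits)
        then show ?thesis
          unfolding T_def using j diff_add_mdvd[OF \<open>mdvd (mlcm l \<sigma>) t\<close>]
          by (intro UN_I[of j]) (auto intro!: image_eqI[of _ _ "t - mlcm l \<sigma>"])
      qed
    qed
    then obtain y where y: "y \<in> free_mod V (length (L (Suc (Suc n))))"
        "\<And>t. coef (Suc (Suc n)) t y = e t" by blast
    have "diff (Suc n) *\<^sub>v y = x"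
    proof (rule coef_eqI[where n = "Suc n", OF _ x_car])
      show "diff (Suc n) *\<^sub>v y \<in> carrier_vec (length (L (Suc n)))"
        by (rule diff_carrier_vec)
      show "coef (Suc n) t (diff (Suc n) *\<^sub>v y) = coef (Suc n) t x" for t
        using y by (simp add: free_mod_def coef_diff e(1))
    qed
    then show "x \<in> ?im" using y(1) by blast
  qed
qed

section \<open>The minimal resolution of the generated ideal\<close>

lemma augmentation_entries:
  "(\<lambda>j. diff 0 $$ (0, j)) ` {..<length (L 1)}
    = (\<lambda>v. Poly_Mapping.single (l v) (1 :: 'k::field)) ` {v. {v} \<in> \<Delta>}"
proof -
  have "diff 0 $$ (0, j) = entry {} (L 1 ! j)" if "j < length (L 1)" for j
    using that by (simp add: diff_def L_0)
  then have "(\<lambda>j. diff 0 $$ (0, j)) ` {..<length (L 1)} = entry {} ` (!) (L 1) ` {..<length (L 1)}"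
    unfolding image_image by (intro image_cong) auto
  also have "(!) (L 1) ` {..<length (L 1)} = set (L 1)"
    by (auto simp: in_set_conv_nth)
  also have "set (L 1) = (\<lambda>v. {v}) ` {v. {v} \<in> \<Delta>}"
    by (auto simp: set_L faces_def card_1_singleton_iff)
  also have "entry {} ` \<dots> = (\<lambda>v. Poly_Mapping.single (l v) (1 :: 'k)) ` {v. {v} \<in> \<Delta>}"
    unfolding image_image
  proof (rule image_cong[OF refl])
    fix v assume "v \<in> {v. {v} \<in> \<Delta>}"
    then have "v \<in> W - {}" using faces_W by auto
    from entry_insert[OF this] show "entry {} {v} = Poly_Mapping.single (l v) (1 :: 'k)"
      by (simp add: incidence_sign_def)
  qed
  finally show ?thesis .
qed

text \<open>Each basis element has the degree of its label, which makes the entries homogeneous.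
  Minimality comes from \<open>strict\<close>: the labels differ, so a non-zero entry is a
  non-constant monomial up to sign.\<close>

theorem minimal_graded_free_resolution_diff:
  "minimal_graded_free_resolution V
    (Idl\<^bsub>poly_ring V\<^esub> ((\<lambda>v. Poly_Mapping.single (l v) (1 :: 'k::field)) ` {v. {v} \<in> \<Delta>}))
    (\<lambda>i. length (L (Suc i))) (\<lambda>i c. int (mon_deg (mlcm l (L (Suc i) ! c)))) diff"
  unfolding minimal_graded_free_resolution_def
proof (intro conjI allI impI)
  have face: "L n ! j \<in> \<Delta>" if "j < length (L n)" for n j
    using L_nth[OF that] by (simp add: faces_def)
  have hom: "homogeneous_of_deg (int (mon_deg (mlcm l \<sigma>)) - int (mon_deg (mlcm l \<tau>)))
      (entry \<tau> \<sigma> :: ('v, 'k) mpoly)" if \<sigma>: "\<sigma> \<in> \<Delta>" for \<sigma> \<tau>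
  proof (cases rule: entry_cases[where 'k = 'k, of \<tau> \<sigma>])
    case zero
    then show ?thesis by (simp add: homogeneous_of_deg_def)
  next
    case (insert v)
    have "mdvd (mlcm l \<tau>) (mlcm l \<sigma>)"
      using finite_face[OF \<sigma>] insert(2) by (intro mlcm_mono) auto
    then have "mon_deg (mlcm l \<sigma>) = mon_deg (mlcm l \<sigma> - mlcm l \<tau>) + mon_deg (mlcm l \<tau>)"
      by (metis diff_add_mdvd mon_deg_add)
    then show ?thesis unfolding insert(3) by (auto simp: homogeneous_of_deg_def split: if_splits)
  qed
  show "(diff 0 :: ('v, 'k) mpoly mat) \<in> carrier_mat 1 (length (L (Suc 0)))"
    by (rule carrier_matI) (simp_all add: L_0)
  show "(diff (Suc i) :: ('v, 'k) mpoly mat) \<in> carrier_mat (length (L (Suc i))) (length (L (Suc (Suc i))))" for i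
    by (rule carrier_matI) simp_all
  show "elements_mat (diff i :: ('v, 'k) mpoly mat) \<subseteq> polys V" for i
  proof
    fix a :: "('v, 'k) mpoly" assume "a \<in> elements_mat (diff i)"
    then obtain r c where "r < length (L i)" "c < length (L (Suc i))" "a = diff i $$ (r, c)"
      using elements_matD by fastforce
    then show "a \<in> polys V" by (simp add: diff_index entry_polys face)
  qed
  show "homogeneous_of_deg (int (mon_deg (mlcm l (L (Suc 0) ! c)))) (diff 0 $$ (0, c) :: ('v, 'k) mpoly)"
    if "c < length (L (Suc 0))" for c
  proof -
    have "diff 0 $$ (0, c) = (entry {} (L (Suc 0) ! c) :: ('v, 'k) mpoly)"
      using that diff_index[of 0 0 c] by (simp add: L_0)
    then show ?thesis using hom[OF face[OF that], of "{}"] by (simp add: mon_deg_def)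
  qed
  show "homogeneous_of_deg (int (mon_deg (mlcm l (L (Suc (Suc i)) ! c))) - int (mon_deg (mlcm l (L (Suc i) ! r))))
      (diff (Suc i) $$ (r, c) :: ('v, 'k) mpoly)"
    if "r < length (L (Suc i))" "c < length (L (Suc (Suc i)))" for i r c
    unfolding diff_index[OF that] by (rule hom[OF face[OF that(2)]])
  have "(diff 0 :: ('v, 'k) mpoly mat) \<in> pmat V 1 (length (L (Suc 0)))"
    using diff_pmat[of 0] by (simp add: L_0)
  from row_image_eq_Idl[OF this] show "(\<lambda>x. (diff 0 *\<^sub>v x) $ 0) ` free_mod V (length (L (Suc 0)))
      = Idl\<^bsub>poly_ring V\<^esub> ((\<lambda>v. Poly_Mapping.single (l v) (1 :: 'k)) ` {v. {v} \<in> \<Delta>})"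
    unfolding augmentation_entries[unfolded One_nat_def] .
  show "(\<lambda>x. diff (Suc i) *\<^sub>v x) ` free_mod V (length (L (Suc (Suc i))))
      = {x \<in> free_mod V (length (L (Suc i))). diff i *\<^sub>v x = 0\<^sub>v (dim_row (diff i :: ('v, 'k) mpoly mat))}" for i
    unfolding dim_diff by (rule exact)
  show "Poly_Mapping.lookup (diff (Suc i) $$ (r, c) :: ('v, 'k) mpoly) 0 = 0"
    if "r < length (L (Suc i))" "c < length (L (Suc (Suc i)))" for i r c
  proof -
    let ?\<tau> = "L (Suc i) ! r" and ?\<sigma> = "L (Suc (Suc i)) ! c"
    have "Poly_Mapping.lookup (entry ?\<tau> ?\<sigma> :: ('v, 'k) mpoly) 0 = 0"
    proof (cases rule: entry_cases[where 'k = 'k, of ?\<tau> ?\<sigma>])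
      case zero
      then show ?thesis by simp
    next
      case (insert v)
      have le: "mdvd (mlcm l ?\<tau>) (mlcm l ?\<sigma>)"
        using finite_face[OF face[OF that(2)]] insert(2) by (intro mlcm_mono) auto
      have "mlcm l ?\<sigma> \<noteq> mlcm l ?\<tau>"
        using strict[of v ?\<tau>] insert(1,2) face[OF that(2)] by simp
      then have "mlcm l ?\<sigma> - mlcm l ?\<tau> \<noteq> 0"
        using diff_add_mdvd[OF le] by auto
      then show ?thesis unfolding insert(3) by (simp add: lookup_single)
    qed
    then show ?thesis unfolding diff_index[OF that] .
  qed
qed

theorem betti_labelled_complex:
  "betti V (Idl\<^bsub>poly_ring V\<^esub> ((\<lambda>v. Poly_Mapping.single (l v) (1 :: 'k::field)) ` {v. {v} \<in> \<Delta>})) i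
    = card {\<sigma> \<in> \<Delta>. card \<sigma> = Suc i}"
  using betti_eq[OF minimal_graded_free_resolution_diff] by (simp add: length_L faces_def)

end

section \<open>Counting faces\<close>

text \<open>The number of pairs \<open>(A, B)\<close> with \<open>A \<in> \<A>\<close>, \<open>B \<subseteq> {1..m}\<close> and \<open>n\<close> elements in total.\<close>

definition weight :: "nat \<Rightarrow> 'a set set \<Rightarrow> nat \<Rightarrow> nat" where
  "weight m \<A> n = (\<Sum>A\<in>\<A>. if card A \<le> n then m choose (n - card A) else 0)"

text \<open>The new element \<open>v\<close> uses up one of the \<open>Suc n\<close> elements. Both
  the path recurrence and the splitting of the cycle come from this.\<close>

lemma weight_union_insert:
  assumes "finite \<A>" "finite \<B>" "\<And>A. A \<in> \<A> \<union> \<B> \<Longrightarrow> v \<notin> A" "\<And>A. A \<in> \<B> \<Longrightarrow> finite A"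
  shows "weight m (\<A> \<union> insert v ` \<B>) (Suc n) = weight m \<A> (Suc n) + weight m \<B> n"
proof -
  have "\<A> \<inter> insert v ` \<B> = {}" using assms(3) by blast
  then have "weight m (\<A> \<union> insert v ` \<B>) (Suc n)
      = weight m \<A> (Suc n) + weight m (insert v ` \<B>) (Suc n)"
    using assms(1,2) by (simp add: weight_def sum.union_disjoint)
  moreover have "inj_on (insert v) \<B>"
    using assms(3) by (intro inj_onI) (metis UnCI insert_ident)
  then have "weight m (insert v ` \<B>) (Suc n)
      = (\<Sum>A\<in>\<B>. if card (insert v A) \<le> Suc n then m choose (Suc n - card (insert v A)) else 0)"
    by (simp add: weight_def sum.reindex)
  moreover have "\<dots> = weight m \<B> n"
    unfolding weight_def using assms(3,4) by (intro sum.cong refl) auto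
  ultimately show ?thesis by simp
qed

lemma weight_0:
  assumes "finite \<A>" "{} \<in> \<A>" "\<And>A. A \<in> \<A> \<Longrightarrow> finite A"
  shows "weight m \<A> 0 = 1"
proof -
  have "weight m \<A> 0 = (\<Sum>A\<in>\<A>. if A = {} then 1 else 0)"
    unfolding weight_def using assms(3) by (intro sum.cong refl) auto
  then show ?thesis using assms(1,2) by simp
qed

section \<open>Independent sets of paths and the recurrence of \<open>K\<close>\<close>

definition path_indep :: "nat \<Rightarrow> nat \<Rightarrow> nat set set" where
  "path_indep l k = {A. A \<subseteq> {l..<l + k} \<and> (\<forall>i\<in>A. Suc i \<notin> A)}"

lemma path_indepI:
  "(\<And>i. i \<in> A \<Longrightarrow> l \<le> i \<and> i < l + k) \<Longrightarrow> (\<And>i. i \<in> A \<Longrightarrow> Suc i \<notin> A) \<Longrightarrow> A \<in> path_indep l k"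
  unfolding path_indep_def by (simp add: subset_eq)

lemma path_indepD:
  assumes "A \<in> path_indep l k" "i \<in> A"
  shows "l \<le> i" "i < l + k" "Suc i \<notin> A"
  using assms unfolding path_indep_def by auto

lemma finite_path_indep: "finite (path_indep l k)"
  by (rule finite_subset[of _ "Pow {l..<l + k}"]) (auto simp: path_indep_def)

lemma path_indep_finite: "A \<in> path_indep l k \<Longrightarrow> finite A"
  by (auto simp: path_indep_def intro: finite_subset)

lemma weight_path_indep_0: "weight m (path_indep l k) 0 = 1"
  by (rule weight_0[OF finite_path_indep _ path_indep_finite]) (auto simp: path_indep_def)

text \<open>Split by the last vertex: if it is chosen, its neighbour \<open>l + k\<close> is
  not.\<close>

lemma path_indep_Suc_Suc:
  "path_indep l (Suc (Suc k)) = path_indep l (Suc k) \<union> insert (l + Suc k) ` path_indep l k"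
proof (intro antisym subsetI)
  fix A assume A: "A \<in> path_indep l (Suc (Suc k))"
  note AD = path_indepD[OF A]
  show "A \<in> path_indep l (Suc k) \<union> insert (l + Suc k) ` path_indep l k"
  proof (cases "l + Suc k \<in> A")
    case True
    have "l + k \<notin> A" using AD(3)[of "l + k"] True by auto
    have "A - {l + Suc k} \<in> path_indep l k"
    proof (rule path_indepI)
      fix i assume i: "i \<in> A - {l + Suc k}"
      then have "i \<noteq> l + k" "i \<noteq> l + Suc k" using \<open>l + k \<notin> A\<close> by auto
      then show "l \<le> i \<and> i < l + k" using AD(1,2)[of i] i by simp
      show "Suc i \<notin> A - {l + Suc k}" using AD(3)[of i] i by simp
    qed
    moreover have "A = insert (l + Suc k) (A - {l + Suc k})" using True by auto
    ultimately show ?thesis by blast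
  next
    case False
    have "A \<in> path_indep l (Suc k)"
    proof (rule path_indepI)
      fix i assume i: "i \<in> A"
      then have "i \<noteq> l + Suc k" using False by auto
      then show "l \<le> i \<and> i < l + Suc k" using AD(1,2)[OF i] by simp
      show "Suc i \<notin> A" using AD(3)[OF i] .
    qed
    then show ?thesis by blast
  qed
next
  fix A assume "A \<in> path_indep l (Suc k) \<union> insert (l + Suc k) ` path_indep l k"
  then consider "A \<in> path_indep l (Suc k)" | B where "A = insert (l + Suc k) B" "B \<in> path_indep l k"
    by blast
  then show "A \<in> path_indep l (Suc (Suc k))"
  proof cases
    case 1
    note AD = path_indepD[OF 1]
    show ?thesis using AD by (intro path_indepI) (simp_all add: less_SucI)
  next
    case 2
    note BD = path_indepD[OF 2(2)]
    show ?thesis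
      unfolding 2(1) using BD by (intro path_indepI) (auto dest: less_imp_le, fastforce+)
  qed
qed

text \<open>Splitting by the last vertex is the recurrence of \<open>K_nat\<close>. The first vertex
  \<open>l\<close> is arbitrary, so paths of equal length starting at 2 and at 3 give the same
  numbers.\<close>

lemma K_nat_eq_weight: "K_nat m k b = weight m (path_indep l k) (Suc b)"
proof (induction k arbitrary: b rule: induct_nat_012)
  case 0
  have "path_indep l 0 = {{}}" by (auto simp: path_indep_def)
  then show ?case by (simp add: weight_def)
next
  case 1
  have "path_indep l (Suc 0) = {{}, {l}}" by (auto simp: path_indep_def)
  then show ?case by (simp add: weight_def)
next
  case (ge2 k)
  have "weight m (path_indep l (Suc (Suc k))) (Suc b)
      = weight m (path_indep l (Suc k)) (Suc b) + weight m (path_indep l k) b"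
    unfolding path_indep_Suc_Suc
    by (rule weight_union_insert) (auto simp: finite_path_indep path_indep_finite, auto simp: path_indep_def)
  \<comment> \<open>For \<open>b = 0\<close> the value of \<open>K_nat\<close> is a base case, and
    the shorter path contributes exactly 1.\<close>
  moreover have "K_nat m (Suc k) 0 = m + Suc k"
    by (cases k) auto
  ultimately show ?case
    using ge2.IH(1) ge2.IH(2)[of b] by (cases b) (simp_all add: weight_path_indep_0)
qed

section \<open>Independent sets of the cycle\<close>

definition cyc_succ :: "nat \<Rightarrow> nat \<Rightarrow> nat" where
  "cyc_succ m i = (if i = m then 1 else Suc i)"

definition cycle_indep :: "nat \<Rightarrow> nat set set" where
  "cycle_indep m = {A. A \<subseteq> {1..m} \<and> (\<forall>i\<in>A. cyc_succ m i \<notin> A)}"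

lemma cycle_indepI:
  "(\<And>i. i \<in> A \<Longrightarrow> 1 \<le> i \<and> i \<le> m) \<Longrightarrow> (\<And>i. i \<in> A \<Longrightarrow> cyc_succ m i \<notin> A) \<Longrightarrow> A \<in> cycle_indep m"
  unfolding cycle_indep_def by (simp add: subset_eq)

text \<open>As 1 and \<open>m\<close> are adjacent, at most one of them is chosen; the rest is
  independent in the path from 2 to \<open>m - 1\<close>, from 3 to \<open>m - 1\<close>, or from 2
  to \<open>m - 2\<close>. For \<open>m = 2\<close> truncated subtraction makes all three paths
  empty, as it should be.\<close>

lemma cycle_indep_eq:
  assumes "m > 1"
  shows "cycle_indep m = path_indep 2 (m - 2) \<union> insert 1 ` path_indep 3 (m - 3)
    \<union> insert m ` path_indep 2 (m - 3)"
proof (intro antisym subsetI)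
  fix A assume "A \<in> cycle_indep m"
  then have A: "A \<subseteq> {1..m}" "\<And>i. i \<in> A \<Longrightarrow> cyc_succ m i \<notin> A"
    by (auto simp: cycle_indep_def)
  have succ: "Suc i \<notin> A" if "i \<in> A" for i
    using A(1) A(2)[OF that] by (cases "i = m") (auto simp: cyc_succ_def)
  have bounds: "1 \<le> i" "i \<le> m" if "i \<in> A" for i
    using A(1) that by auto
  consider "1 \<in> A" | "m \<in> A" "1 \<notin> A" | "1 \<notin> A" "m \<notin> A" by blast
  then show "A \<in> path_indep 2 (m - 2) \<union> insert 1 ` path_indep 3 (m - 3)
      \<union> insert m ` path_indep 2 (m - 3)"
  proof cases
    case 1
    have "m \<notin> A" using A(2)[of m] 1 by (auto simp: cyc_succ_def)
    have "2 \<notin> A" using succ[OF 1] by (simp add: numeral_2_eq_2)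
    have "A - {1} \<in> path_indep 3 (m - 3)"
    proof (rule path_indepI)
      fix i assume i: "i \<in> A - {1}"
      have "i \<noteq> 1" "i \<noteq> 2" "i \<noteq> m" using i \<open>m \<notin> A\<close> \<open>2 \<notin> A\<close> by auto
      then show "3 \<le> i \<and> i < 3 + (m - 3)" using bounds[of i] i by auto
    qed (use succ in simp)
    moreover have "A = insert 1 (A - {1})" using 1 by auto
    ultimately show ?thesis by blast
  next
    case 2
    have "m - 1 \<notin> A" using succ[of "m - 1"] 2 assms by auto
    have "A - {m} \<in> path_indep 2 (m - 3)"
    proof (rule path_indepI)
      fix i assume i: "i \<in> A - {m}"
      have "i \<noteq> 1" "i \<noteq> m - 1" "i \<noteq> m" using i \<open>m - 1 \<notin> A\<close> 2 by auto
      then show "2 \<le> i \<and> i < 2 + (m - 3)" using bounds[of i] i by auto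
    qed (use succ in simp)
    moreover have "A = insert m (A - {m})" using 2 by auto
    ultimately show ?thesis by blast
  next
    case 3
    have "A \<in> path_indep 2 (m - 2)"
    proof (rule path_indepI)
      fix i assume i: "i \<in> A"
      have "i \<noteq> 1" "i \<noteq> m" using i 3 by auto
      then show "2 \<le> i \<and> i < 2 + (m - 2)" using bounds[OF i] by auto
    qed (use succ in simp)
    then show ?thesis by blast
  qed
next
  fix A assume "A \<in> path_indep 2 (m - 2) \<union> insert 1 ` path_indep 3 (m - 3)
    \<union> insert m ` path_indep 2 (m - 3)"
  then consider "A \<in> path_indep 2 (m - 2)" | B where "A = insert 1 B" "B \<in> path_indep 3 (m - 3)"
    | B where "A = insert m B" "B \<in> path_indep 2 (m - 3)" by blast
  then show "A \<in> cycle_indep m"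
  proof cases
    case 1
    have A: "1 \<le> i \<and> i \<le> m" "i \<noteq> m" "Suc i \<notin> A" if "i \<in> A" for i
      using path_indepD[OF 1 that] by auto
    show ?thesis
      by (rule cycle_indepI[OF A(1)]) (simp_all add: A(2,3) cyc_succ_def)
  next
    case 2
    have B: "i \<noteq> 1" "i \<noteq> 2" "1 \<le> i \<and> i \<le> m" "i \<noteq> m" "Suc i \<notin> B" if "i \<in> B" for i
      using path_indepD[OF 2(2) that] by auto
    show ?thesis
      unfolding 2(1)
    proof (rule cycle_indepI)
      fix i assume i: "i \<in> insert 1 B"
      then show "1 \<le> i \<and> i \<le> m" using B(3) assms by auto
      show "cyc_succ m i \<notin> insert 1 B"
      proof (cases "i = 1")
        case True
        then show ?thesis using assms B(2)[of "Suc 1"] by (auto simp: cyc_succ_def)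
      next
        case False
        then have "i \<in> B" using i by simp
        then show ?thesis using B(3,4,5)[of i] by (auto simp: cyc_succ_def)
      qed
    qed
  next
    case 3
    have B: "i \<noteq> 1" "1 \<le> i \<and> i \<le> m" "Suc i \<noteq> m" "i \<noteq> m" "Suc i \<notin> B" if "i \<in> B" for i
      using path_indepD[OF 3(2) that] by auto
    show ?thesis
      unfolding 3(1)
    proof (rule cycle_indepI)
      fix i assume i: "i \<in> insert m B"
      then show "1 \<le> i \<and> i \<le> m" using B(2) assms by auto
      show "cyc_succ m i \<notin> insert m B"
      proof (cases "i = m")
        case True
        then show ?thesis using assms B(1) by (auto simp: cyc_succ_def)
      next
        case False
        then have "i \<in> B" using i by simp
        then show ?thesis using B(3,4,5)[of i] by (auto simp: cyc_succ_def)
      qed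
    qed
  qed
qed

lemma weight_cycle_indep:
  assumes "m > 1"
  shows "weight m (cycle_indep m) (Suc n) = weight m (path_indep 2 (m - 2)) (Suc n)
    + weight m (path_indep 3 (m - 3)) n + weight m (path_indep 2 (m - 3)) n"
proof -
  have "weight m (cycle_indep m) (Suc n)
      = weight m (path_indep 2 (m - 2) \<union> insert 1 ` path_indep 3 (m - 3)) (Suc n)
        + weight m (path_indep 2 (m - 3)) n"
    unfolding cycle_indep_eq[OF assms]
  proof (rule weight_union_insert)
    fix A assume A: "A \<in> path_indep 2 (m - 2) \<union> insert 1 ` path_indep 3 (m - 3) \<union> path_indep 2 (m - 3)"
    \<comment> \<open>The bound \<open>3 + (m - 3) \<le> m\<close> fails for \<open>m = 2\<close>,
      where the path is empty; hence the case distinction at the end.\<close>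
    have "m \<notin> A" if "A \<subseteq> {l..<l + k}" "l + k \<le> m" for l k and A :: "nat set" using that by auto
    from this[of A 2 "m - 2"] this[of A 2 "m - 3"] this[of _ 3 "m - 3"] A assms
    show "m \<notin> A" by (cases "m = 2") (auto simp: path_indep_def)
  qed (auto simp: finite_path_indep path_indep_finite)
  also have "weight m (path_indep 2 (m - 2) \<union> insert 1 ` path_indep 3 (m - 3)) (Suc n)
      = weight m (path_indep 2 (m - 2)) (Suc n) + weight m (path_indep 3 (m - 3)) n"
    by (rule weight_union_insert)
      (auto simp: finite_path_indep path_indep_finite, auto simp: path_indep_def)
  finally show ?thesis .
qed

section \<open>The resolution of \<open>I\<^sub>m\<close>\<close>

text \<open>The vertex \<open>(i, False)\<close> stands for \<open>a\<^sub>i\<close>, the vertex \<open>(i, True)\<close> for \<open>b\<^sub>i\<close>.\<close>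

definition gen_exp :: "nat \<Rightarrow> nat \<times> bool \<Rightarrow> (nat \<times> nat) \<Rightarrow>\<^sub>0 nat" where
  "gen_exp m = (\<lambda>(i, c). if c
    then Poly_Mapping.single (i, 1) 2 + Poly_Mapping.single (cyc_succ m i, 1) 1
      + Poly_Mapping.single (cyc_succ m i, 2) 1
    else Poly_Mapping.single (i, 1) 3 + Poly_Mapping.single (i, 2) 1)"

lemma lookup_gen_exp_False:
  "Poly_Mapping.lookup (gen_exp m (i, False)) (j, k)
    = (if i = j then if k = 1 then 3 else if k = 2 then 1 else 0 else 0)"
  by (simp add: gen_exp_def lookup_add lookup_single when_def)

lemma lookup_gen_exp_True:
  "Poly_Mapping.lookup (gen_exp m (i, True)) (j, k)
    = (if k = 1 then (if i = j then 2 else 0) + (if cyc_succ m i = j then 1 else 0)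
       else if k = 2 \<and> cyc_succ m i = j then 1 else 0)"
  by (simp add: gen_exp_def lookup_add lookup_single when_def)

lemmas lookup_gen_exp = lookup_gen_exp_False lookup_gen_exp_True

text \<open>The join of the independence complex of the cycle with a full simplex.\<close>

definition gen_complex :: "nat \<Rightarrow> (nat \<times> bool) set set" where
  "gen_complex m = {\<sigma>. \<sigma> \<subseteq> {1..m} \<times> UNIV \<and>
    (\<forall>i. (i, False) \<in> \<sigma> \<longrightarrow> (cyc_succ m i, False) \<notin> \<sigma>)}"

lemma cyc_succ_neq: "m > 1 \<Longrightarrow> cyc_succ m i \<noteq> i"
  by (cases "i = m") (simp_all add: cyc_succ_def)

lemma cyc_succ_in: "m > 1 \<Longrightarrow> i \<in> {1..m} \<Longrightarrow> cyc_succ m i \<in> {1..m}"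
  by (cases "i = m") (simp_all add: cyc_succ_def)

lemma cyc_succ_inj: "i \<in> {1..m} \<Longrightarrow> j \<in> {1..m} \<Longrightarrow> cyc_succ m i = cyc_succ m j \<Longrightarrow> i = j"
  by (cases "i = m"; cases "j = m") (simp_all add: cyc_succ_def)

lemma singleton_gen_complex: "m > 1 \<Longrightarrow> {v} \<in> gen_complex m \<longleftrightarrow> v \<in> {1..m} \<times> UNIV"
  using cyc_succ_neq[of m "fst v"] by (cases v) (auto simp: gen_complex_def)

text \<open>The maximum in \<open>mlcm\<close> is attained; a non-zero exponent rules out that only
  the inserted 0 attains it.\<close>

lemma mdvd_mlcm_lookup:
  assumes "finite S" "mdvd s (mlcm l S)" "Poly_Mapping.lookup s x \<noteq> 0"
  shows "\<exists>u\<in>S. Poly_Mapping.lookup s x \<le> Poly_Mapping.lookup (l u) x"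
proof -
  have le: "Poly_Mapping.lookup s x \<le> Max (insert 0 ((\<lambda>v. Poly_Mapping.lookup (l v) x) ` S))"
    using assms(2)[unfolded mdvd_def, THEN spec[of _ x]]
    by (simp only: mlcm.rep_eq assms(1) if_True)
  have "Max (insert 0 ((\<lambda>v. Poly_Mapping.lookup (l v) x) ` S))
      \<in> insert 0 ((\<lambda>v. Poly_Mapping.lookup (l v) x) ` S)"
    using assms(1) by (intro Max_in) auto
  then show ?thesis using le assms(3) by auto
qed

lemma gen_exp_cone:
  assumes m: "m > 1" and v: "{v} \<in> gen_complex m" "mdvd (gen_exp m v) t"
  shows "\<exists>w\<in>{1..m} \<times> UNIV. mdvd (gen_exp m w) t \<and>
    (\<forall>\<sigma>\<in>gen_complex m. mdvd (mlcm (gen_exp m) \<sigma>) t \<longrightarrow> insert w \<sigma> \<in> gen_complex m)"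
proof (cases "\<exists>i\<in>{1..m}. mdvd (gen_exp m (i, True)) t")
  case True
  then obtain i where "i \<in> {1..m}" "mdvd (gen_exp m (i, True)) t" by blast
  \<comment> \<open>A vertex \<open>(i, True)\<close> occurs in no forbidden pair, so it can be
    added to every face.\<close>
  then show ?thesis by (intro bexI[of _ "(i, True)"]) (auto simp: gen_complex_def)
next
  case False
  \<comment> \<open>The exponents of \<open>(i, False)\<close> and \<open>(cyc_succ m i, False)\<close> together dominate that of
    \<open>(i, True)\<close>.\<close>
  have no_edge: "\<not> mdvd (gen_exp m (cyc_succ m i, False)) t"
    if i: "i \<in> {1..m}" "mdvd (gen_exp m (i, False)) t" for i
  proof
    assume j: "mdvd (gen_exp m (cyc_succ m i, False)) t"
    have "Poly_Mapping.lookup t (i, 1) \<ge> 3" "Poly_Mapping.lookup t (cyc_succ m i, 1) \<ge> 3"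
        "Poly_Mapping.lookup t (cyc_succ m i, 2) \<ge> 1"
      using i(2)[unfolded mdvd_def, THEN spec[of _ "(i, 1)"]]
        j[unfolded mdvd_def, THEN spec[of _ "(cyc_succ m i, 1)"]]
        j[unfolded mdvd_def, THEN spec[of _ "(cyc_succ m i, 2)"]]
      by (simp_all add: lookup_gen_exp)
    then have "mdvd (gen_exp m (i, True)) t"
      using cyc_succ_neq[OF m, of i] by (auto simp: mdvd_def lookup_gen_exp)
    then show False using False i(1) by blast
  qed
  obtain i c where ic: "v = (i, c)" by (cases v)
  have "i \<in> {1..m}" using v(1) singleton_gen_complex[OF m] ic by auto
  \<comment> \<open>No vertex with \<open>True\<close> divides \<open>t\<close> in this
    case.\<close>
  then have i: "v = (i, False)" "i \<in> {1..m}"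
    using v(2) False ic by (cases c; auto)+
  \<comment> \<open>By \<open>no_edge\<close> neither neighbour of \<open>i\<close> on the cycle can
    occur in a face dividing \<open>t\<close>, so \<open>v\<close> is an apex.\<close>
  have "insert v \<sigma> \<in> gen_complex m"
    if \<sigma>: "\<sigma> \<in> gen_complex m" "mdvd (mlcm (gen_exp m) \<sigma>) t" for \<sigma>
  proof -
    have fin: "finite \<sigma>" using \<sigma>(1) by (intro finite_subset[of \<sigma> "{1..m} \<times> UNIV"]) (auto simp: gen_complex_def)
    have dvd: "mdvd (gen_exp m (j, False)) t" "j \<in> {1..m}" if "(j, False) \<in> \<sigma>" for j
      using that \<sigma> mlcm_mdvd_iff[OF fin] by (auto simp: gen_complex_def)
    have "(cyc_succ m i, False) \<notin> \<sigma>"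
      using no_edge[of i] dvd v(2) i by blast
    moreover have "cyc_succ m j \<noteq> i" if "(j, False) \<in> \<sigma>" for j
      using no_edge[of j] dvd[OF that] v(2) i by auto
    ultimately show ?thesis
      using \<sigma>(1) i cyc_succ_neq[OF m, of i] by (auto simp: gen_complex_def)
  qed
  then show ?thesis using v(2) i by blast
qed

text \<open>Only \<open>(i, False)\<close> reaches exponent 3 at \<open>(i, 1)\<close>. Apart from
  \<open>(i, True)\<close> itself, only \<open>(i, False)\<close> reaches exponent 2 at
  \<open>(i, 1)\<close>, and only \<open>(cyc_succ m i, False)\<close> involves
  \<open>(cyc_succ m i, 2)\<close>; these two do not lie in a common face.\<close>

lemma gen_exp_strict:
  assumes m: "m > 1" and v: "v \<notin> \<tau>" "insert v \<tau> \<in> gen_complex m"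
  shows "mlcm (gen_exp m) (insert v \<tau>) \<noteq> mlcm (gen_exp m) \<tau>"
proof
  assume eq: "mlcm (gen_exp m) (insert v \<tau>) = mlcm (gen_exp m) \<tau>"
  have sub: "insert v \<tau> \<subseteq> {1..m} \<times> UNIV" using v by (simp add: gen_complex_def)
  have fin: "finite (insert v \<tau>)" by (rule finite_subset[OF sub]) simp
  have dvd: "mdvd (gen_exp m v) (mlcm (gen_exp m) \<tau>)"
    using mdvd_mlcm[OF fin, of v "gen_exp m"] eq by simp
  obtain i c where ic: "v = (i, c)" by (cases v)
  have i: "i \<in> {1..m}" using sub ic by auto
  have dominated: "\<exists>u\<in>\<tau>. Poly_Mapping.lookup (gen_exp m v) x \<le> Poly_Mapping.lookup (gen_exp m u) x"
    if "Poly_Mapping.lookup (gen_exp m v) x \<noteq> 0" for x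
    using fin mdvd_mlcm_lookup[OF _ dvd that] by simp
  have neq: "cyc_succ m j \<noteq> j" for j by (rule cyc_succ_neq[OF m])
  show False
  proof (cases c)
    case False
    have "Poly_Mapping.lookup (gen_exp m v) (i, 1) = 3"
      using ic False by (simp add: lookup_gen_exp)
    then obtain u where u: "u \<in> \<tau>" "Poly_Mapping.lookup (gen_exp m u) (i, 1) \<ge> 3"
      using dominated[of "(i, 1)"] by auto
    then have "u = (i, False)"
      using neq by (cases u; cases "snd u") (auto simp: lookup_gen_exp split: if_splits)
    then show ?thesis using u(1) v(1) ic False by simp
  next
    case True
    have "Poly_Mapping.lookup (gen_exp m v) (i, 1) = 2"
        "Poly_Mapping.lookup (gen_exp m v) (cyc_succ m i, 2) = 1"
      using ic True neq[of i] by (simp_all add: lookup_gen_exp)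
    then obtain u u' where u: "u \<in> \<tau>" "Poly_Mapping.lookup (gen_exp m u) (i, 1) \<ge> 2"
        and u': "u' \<in> \<tau>" "Poly_Mapping.lookup (gen_exp m u') (cyc_succ m i, 2) \<ge> 1"
      using dominated[of "(i, 1)"] dominated[of "(cyc_succ m i, 2)"] by auto
    have "u = (i, False)"
      using u ic True v(1) neq
      by (cases u; cases "snd u") (auto simp: lookup_gen_exp split: if_splits)
    moreover have "u' = (cyc_succ m i, False)"
    proof -
      obtain j d where jd: "u' = (j, d)" by (cases u')
      have "j \<in> {1..m}" using u'(1) sub jd by auto
      then show ?thesis
        using u' jd ic True v(1) cyc_succ_inj[OF i, of j]
        by (cases d) (auto simp: lookup_gen_exp split: if_splits)
    qed
    ultimately show ?thesis
      using u(1) u'(1) v(2) by (auto simp: gen_complex_def)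
  qed
qed

lemma labelled_complex_gen_complex:
  assumes m: "m > 1"
  shows "labelled_complex ({1..m} \<times> UNIV) (gen_complex m) (gen_exp m) (I_vars m)"
proof
  show "finite ({1..m} \<times> (UNIV :: bool set))" by simp
  show "gen_complex m \<subseteq> Pow ({1..m} \<times> UNIV)" by (auto simp: gen_complex_def)
  show "{} \<in> gen_complex m" by (simp add: gen_complex_def)
  show "\<tau> \<in> gen_complex m" if "\<sigma> \<in> gen_complex m" "\<tau> \<subseteq> \<sigma>" for \<sigma> \<tau>
    using that by (auto simp: gen_complex_def)
  show "Poly_Mapping.keys (gen_exp m v) \<subseteq> I_vars m" if "v \<in> {1..m} \<times> UNIV" for v
  proof
    fix x assume x: "x \<in> Poly_Mapping.keys (gen_exp m v)"
    obtain i c where ic: "v = (i, c)" by (cases v)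
    obtain j k where jk: "x = (j, k)" by (cases x)
    have "i \<in> {1..m}" "cyc_succ m i \<in> {1..m}" using that ic cyc_succ_in[OF m, of i] by auto
    moreover have "(j = i \<or> j = cyc_succ m i) \<and> (k = 1 \<or> k = 2)"
      using x ic jk by (cases c) (auto simp: in_keys_iff lookup_gen_exp split: if_splits)
    ultimately show "x \<in> I_vars m" using jk by (auto simp: I_vars_def)
  qed
qed (use gen_exp_cone[OF m] gen_exp_strict[OF m] in blast)+

lemma I_gens_eq:
  assumes m: "m > 1"
  shows "(I_gens m :: (nat \<times> nat, 'k::field) mpoly set)
    = (\<lambda>v. Poly_Mapping.single (gen_exp m v) 1) ` {v. {v} \<in> gen_complex m}"
proof -
  let ?g = "\<lambda>v. Poly_Mapping.single (gen_exp m v) (1 :: 'k)"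
  have pow: "Poly_Mapping.single (Poly_Mapping.single v 1) (1 :: 'k) ^ n
      = Poly_Mapping.single (Poly_Mapping.single v n) 1" for v :: "nat \<times> nat" and n
    by (induction n) (simp_all add: mult_single flip: single_add)
  have a: "Var (i, 1) ^ 3 * Var (i, 2) = ?g (i, False)" for i
    by (simp only: Var_def pow) (simp add: mult_single gen_exp_def)
  have b: "Var (i, 1) ^ 2 * Var (j, 1) * Var (j, 2) = ?g (i, True)" if "j = cyc_succ m i" for i j
    using that by (simp only: Var_def pow) (simp add: mult_single gen_exp_def)
  \<comment> \<open>The index \<open>m\<close> is kept apart because only there the cyclic successor
    wraps around; it gives the last generator.\<close>
  have "(\<lambda>i. Var (i, 1) ^ 2 * Var (i + 1, 1) * Var (i + 1, 2)) ` {1..m - 1}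
      = (\<lambda>i. ?g (i, True)) ` {1..m - 1}"
    by (intro image_cong refl b) (auto simp: cyc_succ_def)
  moreover have "Var (m, 1) ^ 2 * Var (1, 1) * Var (1, 2) = ?g (m, True)"
    by (rule b) (simp add: cyc_succ_def)
  moreover have "{1..m} = insert m {1..m - 1}" using m by auto
  moreover have "{v. {v} \<in> gen_complex m} = (\<lambda>i. (i, False)) ` {1..m} \<union> (\<lambda>i. (i, True)) ` {1..m}"
    by (auto simp: singleton_gen_complex[OF m] UNIV_bool)
  ultimately show ?thesis
    unfolding I_gens_def a by (simp add: image_Un image_image)
qed

text \<open>A face is a pair of its \<open>False\<close> part, independent in the cycle, and its
  \<open>True\<close> part, an arbitrary subset of \<open>{1..m}\<close> counted by a binomial
  coefficient.\<close>

lemma card_gen_complex: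
  "card {\<sigma> \<in> gen_complex m. card \<sigma> = n} = weight m (cycle_indep m) n"
proof -
  let ?F = "\<lambda>A. {B. B \<subseteq> {1..m} \<and> card A + card B = n}"
  let ?S = "SIGMA A:cycle_indep m. ?F A"
  let ?f = "\<lambda>(A, B). A \<times> {False} \<union> B \<times> {True}"
  let ?g = "\<lambda>\<sigma>. ({i. (i, False) \<in> \<sigma>}, {i. (i, True) \<in> \<sigma>})"
  have card_f: "card (A \<times> {False} \<union> B \<times> {True}) = card A + card B"
    if "A \<subseteq> {1..m}" "B \<subseteq> {1..m}" for A B :: "nat set"
  proof -
    have "finite A" "finite B" using that finite_subset by auto
    then show ?thesis by (subst card_Un_disjoint) (auto simp: card_cartesian_product)
  qed
  have f_g: "?f (?g \<sigma>) = \<sigma>" for \<sigma> :: "(nat \<times> bool) set"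
    by (auto split: prod.splits) (metis (full_types))+
  have "bij_betw ?f ?S {\<sigma> \<in> gen_complex m. card \<sigma> = n}"
  proof (rule bij_betw_byWitness[where f' = ?g])
    show "\<forall>p\<in>?S. ?g (?f p) = p" by auto
    show "\<forall>\<sigma>\<in>{\<sigma> \<in> gen_complex m. card \<sigma> = n}. ?f (?g \<sigma>) = \<sigma>" using f_g by blast
    show "?f ` ?S \<subseteq> {\<sigma> \<in> gen_complex m. card \<sigma> = n}"
    proof (rule image_subsetI)
      fix p assume "p \<in> ?S"
      then obtain A B where p: "p = (A, B)" "A \<in> cycle_indep m" "B \<subseteq> {1..m}" "card A + card B = n"
        by auto
      then show "?f p \<in> {\<sigma> \<in> gen_complex m. card \<sigma> = n}"
        using card_f[of A B] by (auto simp: cycle_indep_def gen_complex_def)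
    qed
    show "?g ` {\<sigma> \<in> gen_complex m. card \<sigma> = n} \<subseteq> ?S"
    proof (rule image_subsetI)
      fix \<sigma> assume \<sigma>: "\<sigma> \<in> {\<sigma> \<in> gen_complex m. card \<sigma> = n}"
      let ?A = "{i. (i, False) \<in> \<sigma>}" and ?B = "{i. (i, True) \<in> \<sigma>}"
      have AB: "?A \<subseteq> {1..m}" "?B \<subseteq> {1..m}" using \<sigma> by (auto simp: gen_complex_def)
      have "card ?A + card ?B = n"
        using card_f[OF AB] f_g[of \<sigma>] \<sigma> by simp
      moreover have "?A \<in> cycle_indep m"
        using \<sigma> AB by (simp add: cycle_indep_def gen_complex_def)
      ultimately show "?g \<sigma> \<in> ?S" using AB by simp
    qed
  qed
  then have "card {\<sigma> \<in> gen_complex m. card \<sigma> = n} = card ?S"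
    by (rule bij_betw_same_card[symmetric])
  also have "\<dots> = (\<Sum>A\<in>cycle_indep m. card (?F A))"
  proof (rule card_SigmaI)
    show "finite (cycle_indep m)"
      by (rule finite_subset[of _ "Pow {1..m}"]) (auto simp: cycle_indep_def)
    show "\<forall>A\<in>cycle_indep m. finite (?F A)"
      by (rule ballI, rule finite_subset[of _ "Pow {1..m}"]) auto
  qed
  also have "\<dots> = weight m (cycle_indep m) n"
    unfolding weight_def
  proof (intro sum.cong refl)
    fix A
    show "card (?F A) = (if card A \<le> n then m choose (n - card A) else 0)"
    proof (cases "card A \<le> n")
      case True
      then have "?F A = {B. B \<subseteq> {1..m} \<and> card B = n - card A}" by auto
      then show ?thesis using True n_subsets[of "{1..m}" "n - card A"] by simp
    next
      case False
      then have "?F A = {}" by auto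
      then show ?thesis using False by (simp only: card.empty if_False)
    qed
  qed
  finally show ?thesis .
qed

theorem proposition3p6:
  fixes m :: nat
  assumes "m > 1"
  shows "betti (I_vars m) (I_ideal m :: (nat \<times> nat, 'k::field) mpoly set) 0 = 2 * m \<and>
    (\<forall>i\<ge>1. betti (I_vars m) (I_ideal m :: (nat \<times> nat, 'k) mpoly set) i
        = 2 * K m (int m - 3) (i - 1) + K m (int m - 2) i)"
proof -
  \<comment> \<open>Faces with \<open>i + 1\<close> elements, split according to whether the
    independent set contains neither end, 1, or \<open>m\<close>.\<close>
  have betti: "betti (I_vars m) (I_ideal m :: (nat \<times> nat, 'k) mpoly set) i
      = K_nat m (m - 2) i + weight m (path_indep 3 (m - 3)) i + weight m (path_indep 2 (m - 3)) i" for i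
    using labelled_complex.betti_labelled_complex[OF labelled_complex_gen_complex[OF assms],
        where 'k = 'k, of i]
    by (simp add: I_ideal_def I_gens_eq[OF assms] card_gen_complex weight_cycle_indep[OF assms]
        flip: K_nat_eq_weight)
  have K_m2: "K m (int m - 2) i = K_nat m (m - 2) i" for i
    using assms by (simp add: K_def nat_diff_distrib)
  \<comment> \<open>For \<open>m = 2\<close> the left side is the value at -1, which equals that at
    0, and the truncated \<open>m - 3\<close> is 0.\<close>
  have K_m3: "K m (int m - 3) i = K_nat m (m - 3) i" for i
    using assms by (cases "m = 2") (simp_all add: K_def nat_diff_distrib)
  \<comment> \<open>Here the two shorter paths contribute 1 each, to be added to
    \<open>m + (m - 2)\<close>.\<close>
  have "betti (I_vars m) (I_ideal m :: (nat \<times> nat, 'k) mpoly set) 0 = 2 * m"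
    using K_base(1)[of "int m - 2" m] assms
    by (simp add: betti weight_path_indep_0 K_m2)
  moreover have "betti (I_vars m) (I_ideal m :: (nat \<times> nat, 'k) mpoly set) i
      = 2 * K m (int m - 3) (i - 1) + K m (int m - 2) i" if i: "i \<ge> 1" for i
  proof -
    obtain j where "i = Suc j" using i by (cases i) auto
    then show ?thesis by (simp add: betti K_m2 K_m3 flip: K_nat_eq_weight)
  qed
  ultimately show ?thesis by blast
qed

end
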